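(* Let $N\ge1$, $\mathbb{T}^N=\mathbb{R}^N/\mathbb{Z}^N$, $\gamma>1$, $\gamma'=\gamma/(\gamma-1)$. Let $H\in C^1(\mathbb{R}^N)\cap C^2(\mathbb{R}^N\setminus\{0\})$ be such that for some $C_H>0$ and all $p\in\mathbb{R}^N$ $$C_H^{-1}|p|^\gamma-C_H\le H(p)\le C_H(|p|^\gamma+1),\qquad |\nabla H(p)|\le C_H(|p|^{\gamma-1}+1),\qquad \nabla H(p)\cdot p-H(p)\ge C_H^{-1}|p|^\gamma-C_H .$$ Let $\beta>1$ satisfy $\beta<1+\gamma'/(N-\gamma')$ if $\gamma'<N$ (and $\beta<\infty$ arbitrary if $\gamma'\ge N$). Then there exist $C>0$ and $\delta>1$, depending on $\beta,N,\gamma'$ and $C_H$, such that for every $(u,m)\in C^2(\mathbb{T}^N)\times W^{1,2}(\mathbb{T}^N)$ satisfying $$-\Delta m-\mathrm{div}(\nabla H(\nabla u)\,m)=0\ \text{ weakly in }\mathbb{T}^N,\qquad\int_{\mathbb{T}^N}m\,dx=1,\quad m>0,$$ it holds that $$\|m\|_{L^\beta(\mathbb{T}^N)}^{\delta}\le C\left(\int_{\mathbb{T}^N}|\nabla u|^{\gamma}m\,dx+1\right).$$ Moreover, if $1<\beta<1+\gamma'/N$, then (with $C>0$, $\delta>1$ depending on the same quantities suitably chosen) for every such $(u,m)$ it also holds that $$\|m\|_{L^\beta(\mathbb{T}^N)}^{\delta\beta}\le C\left(\int_{\mathbb{T}^N}|\nabla u|^{\gamma}m\,dx+1\right).$$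
   Context: Weak solution means: $\int_{\mathbb{T}^N}\big(\nabla m\cdot\nabla\varphi+m\,\nabla H(\nabla u)\cdot\nabla\varphi\big)\,dx=0$ for all $\varphi\in C^\infty(\mathbb{T}^N)$. *)

theory Defs
  imports "HOL-Analysis.Analysis"
begin

definition grad :: "(real ^ 'n \<Rightarrow> real) \<Rightarrow> real ^ 'n \<Rightarrow> real ^ 'n"
  where "grad f x = (\<chi> i. frechet_derivative f (at x) (axis i 1))"

text \<open>Meant for open \<open>S\<close> only: differentiability is taken in the full neighbourhood of a point.\<close>

primrec Ck_on :: "nat \<Rightarrow> (real ^ 'n) set \<Rightarrow> (real ^ 'n \<Rightarrow> real) \<Rightarrow> bool"
  where
    "Ck_on 0 S f \<longleftrightarrow> continuous_on S f"
  | "Ck_on (Suc k) S f \<longleftrightarrow>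
       (\<forall>x\<in>S. f differentiable (at x)) \<and> (\<forall>i. Ck_on k S (\<lambda>x. grad f x $ i))"

text \<open>
  Functions on the flat torus \<open>\<real>\<^sup>N / \<int>\<^sup>N\<close> are represented by \<open>\<int>\<^sup>N\<close>-periodic functions on \<open>\<real>\<^sup>N\<close>,
  with \<open>N = CARD('n)\<close>, and the Haar measure of the torus by Lebesgue measure on the closed unit
  cube, which is a fundamental domain up to a null set.
\<close>

definition torus_periodic :: "(real ^ 'n \<Rightarrow> 'b) \<Rightarrow> bool"
  where "torus_periodic f \<longleftrightarrow> (\<forall>x k. (\<forall>i. k $ i \<in> \<int>) \<longrightarrow> f (x + k) = f x)"

abbreviation torus_measure :: "(real ^ 'n) measure"
  where "torus_measure \<equiv> lebesgue_on (cbox 0 One)"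

definition Ck_torus :: "nat \<Rightarrow> (real ^ 'n \<Rightarrow> real) \<Rightarrow> bool"
  where "Ck_torus k f \<longleftrightarrow> torus_periodic f \<and> Ck_on k UNIV f"

definition smooth_torus :: "(real ^ 'n \<Rightarrow> real) \<Rightarrow> bool"
  where "smooth_torus f \<longleftrightarrow> (\<forall>k. Ck_torus k f)"

definition Lp_torus :: "real \<Rightarrow> (real ^ 'n \<Rightarrow> 'b::euclidean_space) \<Rightarrow> bool"
  where "Lp_torus p f \<longleftrightarrow>
    torus_periodic f \<and> f \<in> borel_measurable torus_measure \<and>
    integrable torus_measure (\<lambda>x. norm (f x) powr p)"

text \<open>This is the \<open>L\<^sup>p\<close> norm only for functions satisfying \<^const>\<open>Lp_torus\<close>; otherwise the
  integral has a junk value.\<close>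

definition Lp_norm_torus :: "real \<Rightarrow> (real ^ 'n \<Rightarrow> 'b::euclidean_space) \<Rightarrow> real"
  where "Lp_norm_torus p f =
    (integral\<^sup>L torus_measure (\<lambda>x. norm (f x) powr p)) powr (1 / p)"

definition has_weak_grad :: "(real ^ 'n \<Rightarrow> real) \<Rightarrow> (real ^ 'n \<Rightarrow> real ^ 'n) \<Rightarrow> bool"
  where "has_weak_grad m g \<longleftrightarrow> Lp_torus 1 m \<and> Lp_torus 1 g \<and>
    (\<forall>\<phi> i. smooth_torus \<phi> \<longrightarrow>
      integral\<^sup>L torus_measure (\<lambda>x. m x * grad \<phi> x $ i)
        = - integral\<^sup>L torus_measure (\<lambda>x. g x $ i * \<phi> x))"

text \<open>The weak gradient is unique up to null sets, so the choice below is immaterial under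
  integrals.\<close>

definition weak_grad :: "(real ^ 'n \<Rightarrow> real) \<Rightarrow> real ^ 'n \<Rightarrow> real ^ 'n"
  where "weak_grad m = (SOME g. has_weak_grad m g)"

definition W12_torus :: "(real ^ 'n \<Rightarrow> real) \<Rightarrow> bool"
  where "W12_torus m \<longleftrightarrow> Lp_torus 2 m \<and> (\<exists>g. has_weak_grad m g \<and> Lp_torus 2 g)"

definition admissible_hamiltonian :: "real \<Rightarrow> real \<Rightarrow> (real ^ 'n \<Rightarrow> real) \<Rightarrow> bool"
  where "admissible_hamiltonian \<gamma> C\<^sub>H H \<longleftrightarrow>
    Ck_on 1 UNIV H \<and> Ck_on 2 (UNIV - {0}) H \<and>
    (\<forall>p. inverse C\<^sub>H * norm p powr \<gamma> - C\<^sub>H \<le> H p \<and>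
         H p \<le> C\<^sub>H * (norm p powr \<gamma> + 1) \<and>
         norm (grad H p) \<le> C\<^sub>H * (norm p powr (\<gamma> - 1) + 1) \<and>
         grad H p \<bullet> p - H p \<ge> inverse C\<^sub>H * norm p powr \<gamma> - C\<^sub>H)"

text \<open>Weak form of \<open>- \<Delta>m - div (\<nabla>H(\<nabla>u) m) = 0\<close> on the torus.\<close>

definition weak_solution ::
  "(real ^ 'n \<Rightarrow> real) \<Rightarrow> (real ^ 'n \<Rightarrow> real) \<Rightarrow> (real ^ 'n \<Rightarrow> real) \<Rightarrow> bool"
  where "weak_solution H u m \<longleftrightarrow>
    (\<forall>\<phi>. smooth_torus \<phi> \<longrightarrow>
      integral\<^sup>L torus_measure
        (\<lambda>x. weak_grad m x \<bullet> grad \<phi> x + m x * (grad H (grad u x) \<bullet> grad \<phi> x)) = 0)"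

definition admissible_pair ::
  "(real ^ 'n \<Rightarrow> real) \<Rightarrow> (real ^ 'n \<Rightarrow> real) \<Rightarrow> (real ^ 'n \<Rightarrow> real) \<Rightarrow> bool"
  where "admissible_pair H u m \<longleftrightarrow>
    Ck_torus 2 u \<and> W12_torus m \<and> weak_solution H u m \<and>
    integral\<^sup>L torus_measure m = 1 \<and> (AE x in torus_measure. m x > 0)"

end

theory Submission imports Defs begin

text \<open>
  Testing the equation with a regularized fundamental solution centred at \<open>x\<close> bounds the averages
  of \<open>m\<close> over small cubes, and hence \<open>m\<close> itself, almost everywhere by the potential
  \<open>C \<integral> m(y) (|\<nabla>H(\<nabla>u(y))| + 1) k(x - y) dy\<close> with \<open>k(z)\<close> of the order of \<open>|z|\<close> to the power
  \<open>1 - N\<close>. This replaces Calderon-Zygmund theory: since \<open>\<beta>\<close> is subcritical, only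
  \<open>k \<in> L\<^sup>q\<close> for \<open>q < N / (N - 1)\<close> is needed. The drift is bounded, so splitting off the small values
  of the kernel and absorbing the rest shows that \<open>m\<close> is bounded and all norms are finite a priori.
  A Hoelder inequality for the resulting trilinear form gives
  \<open>\<parallel>m\<parallel> \<le> C \<integral> (|\<nabla>H(\<nabla>u)| + 1)\<^sup>a m\<close> in every subcritical space for the exponent \<open>a \<le> \<gamma>'\<close>;
  interpolation with \<open>\<integral> m = 1\<close> gains the power \<open>\<delta> > 1\<close>.
\<close>

section \<open>Hoelder inequality for several factors\<close>

text \<open>Two obstacles shape the proof. The equation then controls averages of \<open>m\<close>
  over cubes of that size, by a potential that does not depend on \<epsilon>. Moreover,
  \<open>m\<close> is only known to lie in \<open>W12_torus\<close>, whereas the trilinear estimate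
  has powers of the same norm on both sides and must be divided by one of them. Hence boundedness of
  \<open>m\<close> comes first. Its bound depends on the maximum of the drift, so it serves only to
  make integrals finite and never enters a constant. After the division the integral of
  \<open>(|\<nabla>H(\<nabla>u)| + 1)^a m\<close> stands on the right to the first power, with no
  norm of \<open>m\<close> beside it. So the room between \<open>\<beta>\<close> and a larger
  exponent \<open>1 / (1 - \<sigma>)\<close> turns entirely into a power of the norm. The border
  \<open>\<sigma> N = a\<close> corresponds to the critical integrability \<open>N / (N - 1)\<close>
  of the kernel.\<close>

lemma prod_powr_le_weighted_sum:
  fixes x w :: "'i \<Rightarrow> real"
  assumes "finite J" "\<And>i. i \<in> J \<Longrightarrow> w i > 0" "sum w J = 1" "\<And>i. i \<in> J \<Longrightarrow> x i \<ge> 0"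
  shows "(\<Prod>i\<in>J. x i powr w i) \<le> (\<Sum>i\<in>J. w i * x i)"
proof (cases "\<exists>i\<in>J. x i = 0")
  case True
  then have "(\<Prod>i\<in>J. x i powr w i) = 0"
    using assms(1) by (auto intro!: prod_zero)
  moreover have "0 \<le> (\<Sum>i\<in>J. w i * x i)"
    using assms by (intro sum_nonneg mult_nonneg_nonneg) (auto simp: less_imp_le)
  ultimately show ?thesis by simp
next
  case False
  then have pos: "x i > 0" if "i \<in> J" for i
    using assms(4)[OF that] that by fastforce
  have ne: "J \<noteq> {}" using assms(3) by auto
  have "(\<Prod>i\<in>J. x i powr w i) = exp (\<Sum>i\<in>J. w i *\<^sub>R ln (x i))"
    unfolding exp_sum[OF assms(1)] using pos by (intro prod.cong refl) (force simp: powr_def)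
  also have "\<dots> \<le> (\<Sum>i\<in>J. w i * exp (ln (x i)))"
    by (rule convex_on_sum[OF assms(1) ne exp_convex assms(3)]) (auto simp: assms less_imp_le)
  also have "\<dots> = (\<Sum>i\<in>J. w i * x i)"
    using pos by (intro sum.cong) auto
  finally show ?thesis .
qed

text \<open>Once every factor is normalised to integral 1, weighted AM-GM holds pointwise and
  integrates to the claim. A factor with integral 0 vanishes almost everywhere and is treated apart.
  The factors are integrable functions raised to weights with sum 1, rather than members of various
  L^p spaces, because the trilinear form below is split in this way.\<close>

lemma Holder_inequality_prod:
  fixes T :: "'i \<Rightarrow> 'a \<Rightarrow> real" and w :: "'i \<Rightarrow> real"
  assumes J: "finite J" and w: "\<And>i. i \<in> J \<Longrightarrow> w i > 0" "sum w J = 1"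
    and int: "\<And>i. i \<in> J \<Longrightarrow> integrable M (T i)" and nonneg: "\<And>i x. i \<in> J \<Longrightarrow> T i x \<ge> 0"
  shows "integrable M (\<lambda>x. \<Prod>i\<in>J. T i x powr w i)"
    and "(\<integral>x. (\<Prod>i\<in>J. T i x powr w i) \<partial>M) \<le> (\<Prod>i\<in>J. (\<integral>x. T i x \<partial>M) powr w i)"
proof -
  have meas[measurable]: "T i \<in> borel_measurable M" if "i \<in> J" for i
    using int[OF that] by auto
  have I0: "integral\<^sup>L M (T i) \<ge> 0" if "i \<in> J" for i
    using nonneg[OF that] by simp
  have P0: "0 \<le> (\<Prod>i\<in>J. T i x powr w i)" for x
    by (intro prod_nonneg) auto
  show integrable: "integrable M (\<lambda>x. \<Prod>i\<in>J. T i x powr w i)"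
  proof (rule Bochner_Integration.integrable_bound)
    show "integrable M (\<lambda>x. \<Sum>i\<in>J. w i * T i x)"
      using int by auto
    show "AE x in M. norm (\<Prod>i\<in>J. T i x powr w i) \<le> norm (\<Sum>i\<in>J. w i * T i x)"
    proof (rule AE_I2)
      fix x
      have "(\<Prod>i\<in>J. T i x powr w i) \<le> (\<Sum>i\<in>J. w i * T i x)"
        using prod_powr_le_weighted_sum[OF J w] nonneg by simp
      then show "norm (\<Prod>i\<in>J. T i x powr w i) \<le> norm (\<Sum>i\<in>J. w i * T i x)"
        using P0[of x] by simp
    qed
  qed measurable
  show "(\<integral>x. (\<Prod>i\<in>J. T i x powr w i) \<partial>M) \<le> (\<Prod>i\<in>J. (\<integral>x. T i x \<partial>M) powr w i)"
  proof (cases "\<exists>i\<in>J. integral\<^sup>L M (T i) = 0")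
    case True
    then obtain i where i: "i \<in> J" "integral\<^sup>L M (T i) = 0" by blast
    then have "AE x in M. T i x = 0"
      using integral_nonneg_eq_0_iff_AE[OF int[OF i(1)]] nonneg by auto
    then have "AE x in M. (\<Prod>i\<in>J. T i x powr w i) = 0"
      by eventually_elim (use J i in \<open>auto intro!: prod_zero\<close>)
    then have "(\<integral>x. (\<Prod>i\<in>J. T i x powr w i) \<partial>M) = 0"
      using integral_cong_AE[of "\<lambda>x. \<Prod>i\<in>J. T i x powr w i" M "\<lambda>_. 0"] by simp
    then show ?thesis by (simp add: prod_nonneg)
  next
    case False
    then have pos: "integral\<^sup>L M (T i) > 0" if "i \<in> J" for i
      using I0[OF that] that by fastforce
    define c where "c = (\<Prod>i\<in>J. integral\<^sup>L M (T i) powr w i)"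
    have c: "c \<ge> 0" unfolding c_def by (auto intro: prod_nonneg)
    have "(\<Prod>i\<in>J. T i x powr w i) \<le> c * (\<Sum>i\<in>J. w i * (T i x / integral\<^sup>L M (T i)))" for x
    proof -
      have "(\<Prod>i\<in>J. T i x powr w i)
          = (\<Prod>i\<in>J. integral\<^sup>L M (T i) powr w i * (T i x / integral\<^sup>L M (T i)) powr w i)"
        using pos nonneg by (intro prod.cong) (auto simp flip: powr_mult simp: less_imp_neq[OF pos, symmetric])
      also have "\<dots> = c * (\<Prod>i\<in>J. (T i x / integral\<^sup>L M (T i)) powr w i)"
        by (simp add: prod.distrib c_def)
      also have "\<dots> \<le> c * (\<Sum>i\<in>J. w i * (T i x / integral\<^sup>L M (T i)))"
        using pos nonneg w J c
        by (intro mult_left_mono prod_powr_le_weighted_sum) (auto intro!: divide_nonneg_pos)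
      finally show ?thesis .
    qed
    then have "(\<integral>x. (\<Prod>i\<in>J. T i x powr w i) \<partial>M)
        \<le> (\<integral>x. c * (\<Sum>i\<in>J. w i * (T i x / integral\<^sup>L M (T i))) \<partial>M)"
      using integrable int by (intro integral_mono) auto
    also have "\<dots> = c * (\<Sum>i\<in>J. w i)"
      using int pos by (simp add: Bochner_Integration.integral_sum less_imp_neq[OF pos, symmetric])
    finally show ?thesis using w by (simp add: c_def)
  qed
qed

lemma Holder_inequality_two:
  fixes f g :: "'a \<Rightarrow> real"
  assumes "0 < t" "t < 1" and "integrable M f" "integrable M g" "\<And>x. f x \<ge> 0" "\<And>x. g x \<ge> 0"
  shows "integrable M (\<lambda>x. f x powr (1 - t) * g x powr t)"
    and "(\<integral>x. f x powr (1 - t) * g x powr t \<partial>M) \<le> (\<integral>x. f x \<partial>M) powr (1 - t) * (\<integral>x. g x \<partial>M) powr t"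
  using Holder_inequality_prod[of "{False, True}" "\<lambda>b. if b then t else 1 - t" M "\<lambda>b. if b then g else f"]
    assms by simp_all

section \<open>Functions bounded by their own potential\<close>

text \<open>Kernel values above a level \<open>L\<close> have small row and column integrals,
  because there \<open>\<kappa> \<le> L powr (1 - q) * \<kappa> powr q\<close>; values below
  \<open>L\<close> contribute at most a constant. The excess \<open>v\<close> of \<open>m\<close>
  over a suitable level is therefore bounded by a potential of \<open>v\<close> itself with a small
  kernel. Integrating this and using the column bound gives that the integral of \<open>v\<close> is
  at most half of itself. It is finite because \<open>v \<le> m\<close>, so \<open>v\<close>
  vanishes.\<close>

lemma (in sigma_finite_measure) bounded_of_kernel_inequality:
  fixes m :: "'a \<Rightarrow> real" and \<kappa> :: "'a \<Rightarrow> 'a \<Rightarrow> real"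
  assumes m: "integrable M m" "\<And>x. m x \<ge> 0"
    and meas[measurable]: "(\<lambda>(x, y). \<kappa> x y) \<in> borel_measurable (M \<Otimes>\<^sub>M M)"
    and \<kappa>: "\<And>x y. \<kappa> x y \<ge> 0" and q: "q > 1" and A: "A \<ge> 0" and C: "C \<ge> 0"
    and row: "\<And>x. x \<in> space M \<Longrightarrow> (\<integral>\<^sup>+y. ennreal (\<kappa> x y powr q) \<partial>M) \<le> ennreal A"
    and col: "\<And>y. y \<in> space M \<Longrightarrow> (\<integral>\<^sup>+x. ennreal (\<kappa> x y powr q) \<partial>M) \<le> ennreal A"
    and ineq: "AE x in M. ennreal (m x) \<le> ennreal C * (\<integral>\<^sup>+y. ennreal (m y * \<kappa> x y) \<partial>M)"
  shows "\<exists>K\<ge>0. AE x in M. m x \<le> K"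
proof -
  interpret P: pair_sigma_finite M M ..
  have [measurable]: "m \<in> borel_measurable M" using m(1) by auto
  \<comment> \<open>The level makes \<open>C * L powr (1 - q) * A\<close> at most 1/2; the summand 1
    keeps \<open>L\<close> positive even if \<open>C * A = 0\<close>.\<close>
  define L where "L = (2 * C * A + 1) powr (1 / (q - 1))"
  have pos: "2 * C * A + 1 > 0" using A C by (intro add_nonneg_pos) auto
  then have L: "L > 0" unfolding L_def by simp
  have Lq: "L powr (q - 1) = 2 * C * A + 1"
    using q pos by (simp add: L_def powr_powr)
  define \<kappa>L where "\<kappa>L x y = (if \<kappa> x y > L then \<kappa> x y else 0)" for x y
  have [measurable]: "(\<lambda>(x, y). \<kappa>L x y) \<in> borel_measurable (M \<Otimes>\<^sub>M M)"
    unfolding \<kappa>L_def by measurable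
  have \<kappa>L0: "\<kappa>L x y \<ge> 0" for x y using \<kappa> by (simp add: \<kappa>L_def)
  have \<kappa>L_le: "\<kappa>L x y \<le> L powr (1 - q) * \<kappa> x y powr q" for x y
  proof (cases "\<kappa> x y > L")
    case True
    then have "\<kappa> x y = \<kappa> x y powr (1 - q) * \<kappa> x y powr q"
      using L by (simp flip: powr_add)
    also have "\<dots> \<le> L powr (1 - q) * \<kappa> x y powr q"
      using True L q by (intro mult_right_mono powr_mono2') auto
    finally show ?thesis using True by (simp add: \<kappa>L_def)
  qed (auto simp: \<kappa>L_def)
  have half: "C * (L powr (1 - q) * A) \<le> 1 / 2"
  proof -
    have "L powr (1 - q) = 1 / (2 * C * A + 1)"
      using Lq powr_minus_divide[of L "q - 1"] by (simp add: minus_diff_eq)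
    then have "C * (L powr (1 - q) * A) = C * A / (2 * C * A + 1)" by simp
    also have "\<dots> \<le> 1 / 2" using pos by (simp add: divide_simps)
    finally show ?thesis .
  qed
  have bound: "ennreal C * (\<integral>\<^sup>+z. ennreal (f z) \<partial>M) \<le> ennreal (1 / 2)"
    if "\<And>z. f z \<le> L powr (1 - q) * g z powr q" "(\<integral>\<^sup>+z. ennreal (g z powr q) \<partial>M) \<le> ennreal A"
      "g \<in> borel_measurable M" for f g
  proof -
    note [measurable] = that(3)
    have "(\<integral>\<^sup>+z. ennreal (f z) \<partial>M) \<le> (\<integral>\<^sup>+z. ennreal (L powr (1 - q)) * ennreal (g z powr q) \<partial>M)"
      using that(1) by (intro nn_integral_mono) (simp add: ennreal_leI flip: ennreal_mult)
    also have "\<dots> = ennreal (L powr (1 - q)) * (\<integral>\<^sup>+z. ennreal (g z powr q) \<partial>M)"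
      by (rule nn_integral_cmult) measurable
    also have "\<dots> \<le> ennreal (L powr (1 - q)) * ennreal A"
      using that(2) by (intro mult_left_mono) auto
    finally have "ennreal C * (\<integral>\<^sup>+z. ennreal (f z) \<partial>M) \<le> ennreal C * (ennreal (L powr (1 - q)) * ennreal A)"
      by (intro mult_left_mono) auto
    also have "\<dots> = ennreal (C * (L powr (1 - q) * A))"
      using A C by (simp add: ennreal_mult)
    also have "\<dots> \<le> ennreal (1 / 2)" using half by (rule ennreal_leI)
    finally show ?thesis .
  qed
  have rowL: "ennreal C * (\<integral>\<^sup>+y. ennreal (\<kappa>L x y) \<partial>M) \<le> ennreal (1 / 2)" if "x \<in> space M" for x
    using bound[of "\<kappa>L x" "\<kappa> x"] \<kappa>L_le row that by simp
  have colL: "ennreal C * (\<integral>\<^sup>+x. ennreal (\<kappa>L x y) \<partial>M) \<le> ennreal (1 / 2)" if "y \<in> space M" for y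
    using bound[of "\<lambda>x. \<kappa>L x y" "\<lambda>x. \<kappa> x y"] \<kappa>L_le col that by simp
  \<comment> \<open>\<open>c\<close> bounds the contribution of kernel values up to
    \<open>L\<close>. Inserting \<open>m \<le> v + 2 * c\<close> into the rest costs
    \<open>2 * c\<close> times the row bound 1/2, another \<open>c\<close>. The sum is exactly the
    level \<open>2 * c\<close> that is subtracted in \<open>v\<close>, so it cancels.\<close>
  define c where "c = C * (L * integral\<^sup>L M m)"
  have c: "c \<ge> 0" using C L m by (simp add: c_def)
  define v where "v x = max 0 (m x - 2 * c)" for x
  have [measurable]: "v \<in> borel_measurable M" unfolding v_def by measurable
  have v0: "v x \<ge> 0" and mv: "m x \<le> v x + 2 * c" and vm: "v x \<le> m x" for x
    using m(2)[of x] c by (auto simp: v_def)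
  have "AE x in M. ennreal (v x) \<le> ennreal C * (\<integral>\<^sup>+y. ennreal (v y * \<kappa>L x y) \<partial>M)"
    using ineq AE_space
  proof eventually_elim
    case (elim x)
    note [simp] = elim(2)
    let ?Z = "ennreal C * (\<integral>\<^sup>+y. ennreal (v y * \<kappa>L x y) \<partial>M)"
    have "m y * \<kappa> x y \<le> L * m y + (v y * \<kappa>L x y + 2 * c * \<kappa>L x y)" for y
    proof (cases "\<kappa> x y > L")
      case True
      have "m y * \<kappa> x y \<le> (v y + 2 * c) * \<kappa> x y" using mv \<kappa> by (intro mult_right_mono)
      moreover have "L * m y \<ge> 0" using L m by simp
      ultimately show ?thesis using True by (simp add: \<kappa>L_def algebra_simps)
    next
      case False
      then have "\<kappa> x y * m y \<le> L * m y" using m(2)[of y] by (intro mult_right_mono) auto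
      with False show ?thesis by (simp add: \<kappa>L_def mult.commute)
    qed
    then have "ennreal (m y * \<kappa> x y) \<le> ennreal L * ennreal (m y) + (ennreal (v y * \<kappa>L x y)
        + ennreal (2 * c) * ennreal (\<kappa>L x y))" for y
      using L m(2)[of y] v0[of y] \<kappa>L0[of x y] c
      by (simp flip: ennreal_mult ennreal_plus add: ennreal_leI)
    then have "(\<integral>\<^sup>+y. ennreal (m y * \<kappa> x y) \<partial>M) \<le> (\<integral>\<^sup>+y. ennreal L * ennreal (m y)
        + (ennreal (v y * \<kappa>L x y) + ennreal (2 * c) * ennreal (\<kappa>L x y)) \<partial>M)"
      by (intro nn_integral_mono) auto
    also have "\<dots> = ennreal (L * integral\<^sup>L M m) + ((\<integral>\<^sup>+y. ennreal (v y * \<kappa>L x y) \<partial>M)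
        + ennreal (2 * c) * (\<integral>\<^sup>+y. ennreal (\<kappa>L x y) \<partial>M))"
      using L m by (simp add: nn_integral_add nn_integral_cmult nn_integral_eq_integral ennreal_mult)
    finally have "ennreal C * (\<integral>\<^sup>+y. ennreal (m y * \<kappa> x y) \<partial>M) \<le> ennreal C * (ennreal (L * integral\<^sup>L M m)
        + ((\<integral>\<^sup>+y. ennreal (v y * \<kappa>L x y) \<partial>M) + ennreal (2 * c) * (\<integral>\<^sup>+y. ennreal (\<kappa>L x y) \<partial>M)))"
      by (intro mult_left_mono) auto
    also have "\<dots> = ennreal c + (?Z + ennreal (2 * c) * (ennreal C * (\<integral>\<^sup>+y. ennreal (\<kappa>L x y) \<partial>M)))"
      using C L m(2) by (simp add: distrib_left c_def ennreal_mult mult_ac)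
    also have "\<dots> \<le> ennreal c + (?Z + ennreal (2 * c) * ennreal (1 / 2))"
      using rowL[of x] by (intro add_left_mono mult_left_mono) auto
    also have "ennreal (2 * c) * ennreal (1 / 2) = ennreal c"
      using ennreal_mult[of "2 * c" "1 / 2"] c by simp
    also have "ennreal c + (?Z + ennreal c) = ?Z + ennreal (2 * c)"
      using ennreal_plus[OF c c] by (simp add: ac_simps)
    finally have le: "ennreal (m x) \<le> ?Z + ennreal (2 * c)" using elim(1) by (rule order_trans[rotated])
    show "ennreal (v x) \<le> ?Z"
    proof (cases ?Z)
      case (real z)
      then have "m x \<le> z + 2 * c"
        using le c by (simp flip: ennreal_plus)
      then show ?thesis using real by (auto simp: v_def intro!: ennreal_leI)
    qed auto
  qed
  then have "(\<integral>\<^sup>+x. ennreal (v x) \<partial>M) \<le> (\<integral>\<^sup>+x. ennreal C * (\<integral>\<^sup>+y. ennreal (v y * \<kappa>L x y) \<partial>M) \<partial>M)"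
    by (rule nn_integral_mono_AE)
  also have "\<dots> = ennreal C * (\<integral>\<^sup>+x. \<integral>\<^sup>+y. ennreal (v y * \<kappa>L x y) \<partial>M \<partial>M)"
    by (rule nn_integral_cmult) measurable
  also have "(\<integral>\<^sup>+x. \<integral>\<^sup>+y. ennreal (v y * \<kappa>L x y) \<partial>M \<partial>M) = (\<integral>\<^sup>+y. \<integral>\<^sup>+x. ennreal (v y * \<kappa>L x y) \<partial>M \<partial>M)"
    by (rule P.Fubini'[symmetric]) measurable
  also have "\<dots> = (\<integral>\<^sup>+y. ennreal (v y) * (\<integral>\<^sup>+x. ennreal (\<kappa>L x y) \<partial>M) \<partial>M)"
    using v0 \<kappa>L0 by (simp add: ennreal_mult nn_integral_cmult cong: nn_integral_cong_simp)
  also have "ennreal C * \<dots> = (\<integral>\<^sup>+y. ennreal C * (ennreal (v y) * (\<integral>\<^sup>+x. ennreal (\<kappa>L x y) \<partial>M)) \<partial>M)"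
    by (rule nn_integral_cmult[symmetric]) measurable
  also have "\<dots> = (\<integral>\<^sup>+y. ennreal (v y) * (ennreal C * (\<integral>\<^sup>+x. ennreal (\<kappa>L x y) \<partial>M)) \<partial>M)"
    by (simp add: mult_ac)
  also have "\<dots> \<le> (\<integral>\<^sup>+y. ennreal (v y) * ennreal (1 / 2) \<partial>M)"
    using colL by (intro nn_integral_mono mult_left_mono) auto
  also have "\<dots> = (\<integral>\<^sup>+y. ennreal (v y) \<partial>M) * ennreal (1 / 2)"
    by (rule nn_integral_multc) measurable
  finally have le: "(\<integral>\<^sup>+x. ennreal (v x) \<partial>M) \<le> (\<integral>\<^sup>+y. ennreal (v y) \<partial>M) * ennreal (1 / 2)" .
  have vint: "integrable M v"
    by (rule Bochner_Integration.integrable_bound[OF m(1)]) (use v0 vm m in \<open>auto simp: abs_le_iff\<close>)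
  have I0: "integral\<^sup>L M v \<ge> 0" using v0 by simp
  have "ennreal (integral\<^sup>L M v) \<le> ennreal (integral\<^sup>L M v) * ennreal (1 / 2)"
    using le nn_integral_eq_integral[OF vint] v0 by simp
  also have "\<dots> = ennreal (integral\<^sup>L M v * (1 / 2))"
    using I0 by (intro ennreal_mult[symmetric]) auto
  finally have "integral\<^sup>L M v \<le> integral\<^sup>L M v * (1 / 2)"
    using I0 by (subst (asm) ennreal_le_iff) auto
  then have "integral\<^sup>L M v = 0" using I0 by simp
  then have "AE x in M. v x = 0"
    using integral_nonneg_eq_0_iff_AE[OF vint] v0 by simp
  then have "AE x in M. m x \<le> 2 * c"
    by eventually_elim (auto simp: v_def max_def split: if_splits)
  then show ?thesis using c by (intro exI[of _ "2 * c"]) auto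
qed

lemma (in sigma_finite_measure) integrable_pair_kernel:
  fixes f :: "'a \<Rightarrow> real" and k :: "'a \<Rightarrow> 'a \<Rightarrow> real"
  assumes f: "integrable M f" "\<And>x. f x \<ge> 0"
    and k[measurable]: "(\<lambda>(x, y). k x y) \<in> borel_measurable (M \<Otimes>\<^sub>M M)"
    and k0: "\<And>x y. k x y \<ge> 0" and A: "A \<ge> 0"
    and row: "\<And>x. x \<in> space M \<Longrightarrow> (\<integral>\<^sup>+y. ennreal (k x y) \<partial>M) \<le> ennreal A"
  shows "integrable (M \<Otimes>\<^sub>M M) (\<lambda>(x, y). f x * k x y)"
    and "(\<integral>(x, y). f x * k x y \<partial>(M \<Otimes>\<^sub>M M)) \<le> integral\<^sup>L M f * A"
proof -
  have [measurable]: "f \<in> borel_measurable M" using f by auto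
  have "(\<integral>\<^sup>+(x, y). ennreal (f x * k x y) \<partial>(M \<Otimes>\<^sub>M M)) = (\<integral>\<^sup>+x. \<integral>\<^sup>+y. ennreal (f x * k x y) \<partial>M \<partial>M)"
    by (subst nn_integral_fst[symmetric]) auto
  also have "\<dots> = (\<integral>\<^sup>+x. ennreal (f x) * (\<integral>\<^sup>+y. ennreal (k x y) \<partial>M) \<partial>M)"
    using f k0 by (simp add: ennreal_mult nn_integral_cmult cong: nn_integral_cong_simp)
  also have "\<dots> \<le> (\<integral>\<^sup>+x. ennreal (f x) * ennreal A \<partial>M)"
    using row by (intro nn_integral_mono mult_left_mono) auto
  also have "\<dots> = ennreal (integral\<^sup>L M f * A)"
    using f A by (simp add: nn_integral_multc nn_integral_eq_integral ennreal_mult)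
  finally have le: "(\<integral>\<^sup>+p. ennreal (case p of (x, y) \<Rightarrow> f x * k x y) \<partial>(M \<Otimes>\<^sub>M M)) \<le> ennreal (integral\<^sup>L M f * A)"
    by (simp add: split_def)
  show int: "integrable (M \<Otimes>\<^sub>M M) (\<lambda>(x, y). f x * k x y)"
    by (rule integrableI_nonneg) (use f k0 order.strict_trans1[OF le ennreal_less_top] in auto)
  show "(\<integral>(x, y). f x * k x y \<partial>(M \<Otimes>\<^sub>M M)) \<le> integral\<^sup>L M f * A"
    using nn_integral_eq_integral[OF int] le f k0 A by (simp add: case_prod_beta)
qed

lemma (in sigma_finite_measure) integrable_pair_kernel_swap:
  fixes f :: "'a \<Rightarrow> real" and k :: "'a \<Rightarrow> 'a \<Rightarrow> real"
  assumes f: "integrable M f" "\<And>x. f x \<ge> 0"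
    and k[measurable]: "(\<lambda>(x, y). k x y) \<in> borel_measurable (M \<Otimes>\<^sub>M M)"
    and k0: "\<And>x y. k x y \<ge> 0" and A: "A \<ge> 0"
    and col: "\<And>y. y \<in> space M \<Longrightarrow> (\<integral>\<^sup>+x. ennreal (k x y) \<partial>M) \<le> ennreal A"
  shows "integrable (M \<Otimes>\<^sub>M M) (\<lambda>(x, y). f y * k x y)"
    and "(\<integral>(x, y). f y * k x y \<partial>(M \<Otimes>\<^sub>M M)) \<le> integral\<^sup>L M f * A"
proof -
  interpret P: pair_sigma_finite M M ..
  have [measurable]: "f \<in> borel_measurable M" using f by auto
  note * = integrable_pair_kernel[of f "\<lambda>x y. k y x" A, OF f _ k0 A col]
  have int: "integrable (M \<Otimes>\<^sub>M M) (\<lambda>(x, y). f x * k y x)" by (rule *(1)) auto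
  then show "integrable (M \<Otimes>\<^sub>M M) (\<lambda>(x, y). f y * k x y)"
    using P.integrable_product_swap[OF int] by simp
  have "(\<integral>(x, y). f y * k x y \<partial>(M \<Otimes>\<^sub>M M)) = (\<integral>(x, y). f x * k y x \<partial>(M \<Otimes>\<^sub>M M))"
    using P.integral_product_swap[of "\<lambda>(x, y). f x * k y x"] by simp
  also have "\<dots> \<le> integral\<^sup>L M f * A" by (rule *(2)) auto
  finally show "(\<integral>(x, y). f y * k x y \<partial>(M \<Otimes>\<^sub>M M)) \<le> integral\<^sup>L M f * A" .
qed

text \<open>After multiplication by \<open>m\<^sup>\<beta>\<^sup>-\<^sup>1\<close> and integration, the right-hand side is a trilinear form
  that is estimated by a single four-term Hoelder inequality on the product space.\<close>

lemma (in sigma_finite_measure) Lp_estimate_of_kernel_inequality: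
  fixes m B :: "'a \<Rightarrow> real" and \<kappa> :: "'a \<Rightarrow> 'a \<Rightarrow> real"
  assumes m: "integrable M m" "\<And>x. m x \<ge> 0" and bdd: "AE x in M. m x \<le> K"
    and B[measurable]: "B \<in> borel_measurable M" and B0: "\<And>x. B x \<ge> 0"
    and Bb: "\<And>x. x \<in> space M \<Longrightarrow> B x \<le> K'"
    and meas[measurable]: "(\<lambda>(x, y). \<kappa> x y) \<in> borel_measurable (M \<Otimes>\<^sub>M M)"
    and \<kappa>: "\<And>x y. \<kappa> x y \<ge> 0" and A: "A > 0" and C: "C \<ge> 0"
    and a: "a > 1" and \<sigma>: "0 < \<sigma>" "\<sigma> < 1" and q: "q * (1 - \<sigma> / a) = 1" and \<beta>: "\<beta> * (1 - \<sigma>) = 1"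
    and row: "\<And>x. x \<in> space M \<Longrightarrow> (\<integral>\<^sup>+y. ennreal (\<kappa> x y powr q) \<partial>M) \<le> ennreal A"
    and col: "\<And>y. y \<in> space M \<Longrightarrow> (\<integral>\<^sup>+x. ennreal (\<kappa> x y powr q) \<partial>M) \<le> ennreal A"
    and ineq: "AE x in M. ennreal (m x) \<le> ennreal C * (\<integral>\<^sup>+y. ennreal (m y * B y * \<kappa> x y) \<partial>M)"
  shows "integrable M (\<lambda>x. m x powr \<beta>)" (is ?int1)
    and "integrable M (\<lambda>x. m x * B x powr a)" (is ?int2)
    and "(\<integral>x. m x powr \<beta> \<partial>M) powr (1 - \<sigma>) \<le> C powr a * A powr (a - \<sigma>) * (\<integral>x. m x * B x powr a \<partial>M)" (is ?est)
proof -
  interpret P: pair_sigma_finite M M ..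
  have [measurable]: "m \<in> borel_measurable M" using m(1) by auto
  have \<beta>1: "\<beta> > 1"
  proof -
    have "\<beta> = 1 / (1 - \<sigma>)" using \<beta> \<sigma> by (simp add: field_simps)
    then show ?thesis using \<sigma> by simp
  qed
  have \<beta>\<sigma>: "\<beta> * \<sigma> = \<beta> - 1" using \<beta> by (simp add: algebra_simps)
  have q_pos: "q > 0"
  proof -
    have "1 - \<sigma> / a > 0" using \<sigma> a by simp
    then show ?thesis using q by (metis zero_less_mult_pos2 zero_less_one)
  qed
  show int1: ?int1
  proof (rule Bochner_Integration.integrable_bound)
    show "integrable M (\<lambda>x. K powr (\<beta> - 1) * m x)" using m by auto
    show "AE x in M. norm (m x powr \<beta>) \<le> norm (K powr (\<beta> - 1) * m x)"
      using bdd
    proof eventually_elim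
      case (elim x)
      have "m x powr \<beta> = m x powr (\<beta> - 1) * m x"
        using m(2)[of x] \<beta>1 by (cases "m x = 0") (auto simp: powr_diff)
      also have "\<dots> \<le> K powr (\<beta> - 1) * m x"
        using elim m(2)[of x] \<beta>1 by (intro mult_right_mono powr_mono2) auto
      finally show ?case using m(2)[of x] by simp
    qed
  qed measurable
  show int2: ?int2
  proof (rule Bochner_Integration.integrable_bound)
    show "integrable M (\<lambda>x. K' powr a * m x)" using m by auto
    show "AE x in M. norm (m x * B x powr a) \<le> norm (K' powr a * m x)"
      using B0 Bb a m by (intro AE_I2) (auto simp: mult.commute intro!: mult_left_mono powr_mono2)
  qed measurable
  define X where "X = (\<integral>x. m x powr \<beta> \<partial>M)"
  define E where "E = (\<integral>x. m x * B x powr a \<partial>M)"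
  define e where "e = (\<lambda>x. m x * B x powr a)"
  have e0: "e x \<ge> 0" for x using m by (simp add: e_def)
  have e_int: "integrable M e" using int2 by (simp add: e_def)
  have [measurable]: "e \<in> borel_measurable M" unfolding e_def by measurable
  have E: "E = integral\<^sup>L M e" by (simp add: E_def e_def)
  have X0: "X \<ge> 0" and E0: "E \<ge> 0" using e0 by (simp_all add: X_def E)
  \<comment> \<open>The weights are the products of \<open>\<sigma>, 1 - \<sigma>\<close> with
    \<open>1 / a, 1 - 1 / a\<close>, and they are forced. With \<open>m y * B y\<close> written as
    \<open>e y powr (1 / a) * m y powr (1 - 1 / a)\<close>, comparing exponents requires
    \<open>w 0 + w 1 = \<sigma>\<close>, \<open>w 0 + w 2 = 1 / a\<close> and
    \<open>w 3 = (1 - \<sigma>) * (1 - 1 / a)\<close>. Only \<open>T 0\<close> lacks the kernel, so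
    its exponent is right precisely when \<open>q * (1 - w 0) = 1\<close>. Each of the other three
    has a factor in one variable alone and needs just the row or the column bound.\<close>
  define w where "w i = (if i = 0 then \<sigma> / a else if i = 1 then \<sigma> * (1 - 1 / a)
    else if i = 2 then (1 - \<sigma>) / a else (1 - \<sigma>) * (1 - 1 / a))" for i :: nat
  define T where "T i = (if i = 0 then (\<lambda>(x, y). m x powr \<beta> * e y)
    else if i = 1 then (\<lambda>(x, y). m x powr \<beta> * \<kappa> x y powr q)
    else if i = 2 then (\<lambda>(x, y). e y * \<kappa> x y powr q)
    else (\<lambda>(x, y). m y powr \<beta> * \<kappa> x y powr q))" for i :: nat
  define J where "J = {0, 1, 2, 3 :: nat}"
  have J: "finite J" by (simp add: J_def)
  have w_pos: "w i > 0" for i using \<sigma> a by (auto simp: w_def)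
  have w_sum: "sum w J = 1" using a by (simp add: w_def J_def field_simps)
  have T0: "T i p \<ge> 0" for i p using e0 by (auto simp: T_def split: prod.splits)
  have kq: "(\<lambda>(x, y). \<kappa> x y powr q) \<in> borel_measurable (M \<Otimes>\<^sub>M M)" by measurable
  note k1 = integrable_pair_kernel[OF _ _ kq _ less_imp_le[OF A] row, simplified]
  note k2 = integrable_pair_kernel_swap[OF _ _ kq _ less_imp_le[OF A] col, simplified]
  have e_meas: "(\<lambda>(x, y). e y) \<in> borel_measurable (M \<Otimes>\<^sub>M M)" by measurable
  have "(\<integral>\<^sup>+y. ennreal (e y) \<partial>M) \<le> ennreal E"
    using e_int e0 by (simp add: nn_integral_eq_integral E)
  note pe = integrable_pair_kernel[OF int1 _ e_meas e0 E0 this, simplified]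
  have prod_int: "integrable (M \<Otimes>\<^sub>M M) (\<lambda>(x, y). m x powr \<beta> * e y)"
    using pe(1) .
  have T_int: "integrable (M \<Otimes>\<^sub>M M) (T i)" for i
    using k1(1)[OF int1] k2(1)[OF e_int] k2(1)[OF int1] prod_int e0 by (auto simp: T_def)
  have I0: "integral\<^sup>L (M \<Otimes>\<^sub>M M) (T 0) \<le> X * E"
    using pe(2) by (simp add: T_def X_def)
  have I1: "integral\<^sup>L (M \<Otimes>\<^sub>M M) (T 1) \<le> X * A"
    using k1(2)[OF int1] by (simp add: T_def X_def)
  have I2: "integral\<^sup>L (M \<Otimes>\<^sub>M M) (T 2) \<le> E * A"
    using k2(2)[OF e_int] e0 by (simp add: T_def E)
  have I3: "integral\<^sup>L (M \<Otimes>\<^sub>M M) (T 3) \<le> X * A"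
    using k2(2)[OF int1] by (simp add: T_def X_def)
  note H = Holder_inequality_prod[of J w "M \<Otimes>\<^sub>M M" T, OF J w_pos w_sum T_int T0]
  have pointwise: "(\<Prod>i\<in>J. T i (x, y) powr w i) = m x powr (\<beta> - 1) * (m y * B y * \<kappa> x y)" for x y
  proof -
    have ey: "e y powr (1 / a) = m y powr (1 / a) * B y"
      using m(2)[of y] B0[of y] a by (simp add: e_def powr_mult powr_powr)
    have m1: "m y powr (1 / a) * m y powr (1 - 1 / a) = m y"
      using m(2)[of y] by (simp flip: powr_add)
    have k1: "\<kappa> x y powr (q * (1 - \<sigma> / a)) = \<kappa> x y" using q \<kappa> by simp
    have "(\<Prod>i\<in>J. T i (x, y) powr w i)
        = (m x powr (\<beta> * (\<sigma> / a)) * m x powr (\<beta> * (\<sigma> * (1 - 1 / a))))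
          * (e y powr (\<sigma> / a) * e y powr ((1 - \<sigma>) / a)) * m y powr (\<beta> * ((1 - \<sigma>) * (1 - 1 / a)))
          * (\<kappa> x y powr (q * (\<sigma> * (1 - 1 / a))) * \<kappa> x y powr (q * ((1 - \<sigma>) / a))
            * \<kappa> x y powr (q * ((1 - \<sigma>) * (1 - 1 / a))))"
      using m(2) \<kappa> e0 by (simp add: J_def T_def w_def powr_mult powr_powr mult_ac)
    also have "\<dots> = m x powr (\<beta> * \<sigma>) * e y powr (1 / a) * m y powr (\<beta> * (1 - \<sigma>) * (1 - 1 / a))
          * \<kappa> x y powr (q * (1 - \<sigma> / a))"
    proof -
      have "\<beta> * (\<sigma> / a) + \<beta> * (\<sigma> * (1 - 1 / a)) = \<beta> * \<sigma>"
        and "\<sigma> / a + (1 - \<sigma>) / a = 1 / a"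
        and "q * (\<sigma> * (1 - 1 / a)) + q * ((1 - \<sigma>) / a) + q * ((1 - \<sigma>) * (1 - 1 / a)) = q * (1 - \<sigma> / a)"
        by (simp_all add: algebra_simps flip: add_divide_distrib)
      then show ?thesis by (simp only: powr_add[symmetric] mult.assoc)
    qed
    also have "\<dots> = m x powr (\<beta> - 1) * (m y powr (1 / a) * m y powr (1 - 1 / a)) * B y * \<kappa> x y"
      by (simp only: \<beta>\<sigma> ey \<beta> k1 mult_1 mult_ac)
    finally show ?thesis by (simp only: m1 mult_ac)
  qed
  have Xle: "X \<le> C * (\<Prod>i\<in>J. integral\<^sup>L (M \<Otimes>\<^sub>M M) (T i) powr w i)"
  proof -
    have "ennreal X = (\<integral>\<^sup>+x. ennreal (m x powr \<beta>) \<partial>M)"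
      unfolding X_def using int1 by (simp add: nn_integral_eq_integral)
    also have "\<dots> \<le> (\<integral>\<^sup>+x. ennreal C * (\<integral>\<^sup>+y. ennreal (m x powr (\<beta> - 1) * (m y * B y * \<kappa> x y)) \<partial>M) \<partial>M)"
    proof (rule nn_integral_mono_AE)
      show "AE x in M. ennreal (m x powr \<beta>)
          \<le> ennreal C * (\<integral>\<^sup>+y. ennreal (m x powr (\<beta> - 1) * (m y * B y * \<kappa> x y)) \<partial>M)"
        using ineq AE_space
      proof eventually_elim
        case (elim x)
        note [simp] = elim(2)
        have "ennreal (m x powr \<beta>) = ennreal (m x powr (\<beta> - 1)) * ennreal (m x)"
          using m(2)[of x] \<beta>1 by (cases "m x = 0") (auto simp: powr_diff simp flip: ennreal_mult)
        also have "\<dots> \<le> ennreal (m x powr (\<beta> - 1)) * (ennreal C * (\<integral>\<^sup>+y. ennreal (m y * B y * \<kappa> x y) \<partial>M))"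
          using elim(1) by (intro mult_left_mono) auto
        also have "\<dots> = ennreal C * (ennreal (m x powr (\<beta> - 1)) * (\<integral>\<^sup>+y. ennreal (m y * B y * \<kappa> x y) \<partial>M))"
          by (simp add: mult_ac)
        also have "ennreal (m x powr (\<beta> - 1)) * (\<integral>\<^sup>+y. ennreal (m y * B y * \<kappa> x y) \<partial>M)
            = (\<integral>\<^sup>+y. ennreal (m x powr (\<beta> - 1) * (m y * B y * \<kappa> x y)) \<partial>M)"
          using m B0 \<kappa> by (subst nn_integral_cmult[symmetric]) (auto simp: ennreal_mult)
        finally show ?case .
      qed
    qed
    also have "\<dots> = ennreal C * (\<integral>\<^sup>+x. \<integral>\<^sup>+y. ennreal (\<Prod>i\<in>J. T i (x, y) powr w i) \<partial>M \<partial>M)"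
      unfolding pointwise by (rule nn_integral_cmult) measurable
    also have "\<dots> = ennreal C * (\<integral>\<^sup>+p. ennreal (\<Prod>i\<in>J. T i p powr w i) \<partial>(M \<Otimes>\<^sub>M M))"
      using H(1) by (subst nn_integral_fst[symmetric]) auto
    also have "\<dots> = ennreal (C * (\<integral>p. (\<Prod>i\<in>J. T i p powr w i) \<partial>(M \<Otimes>\<^sub>M M)))"
      using H(1) C by (simp add: nn_integral_eq_integral prod_nonneg ennreal_mult)
    finally have "X \<le> C * (\<integral>p. (\<Prod>i\<in>J. T i p powr w i) \<partial>(M \<Otimes>\<^sub>M M))"
      using C by (subst (asm) ennreal_le_iff) (auto intro!: mult_nonneg_nonneg integral_nonneg_AE prod_nonneg)
    also have "\<dots> \<le> C * (\<Prod>i\<in>J. integral\<^sup>L (M \<Otimes>\<^sub>M M) (T i) powr w i)"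
      using H(2) C by (intro mult_left_mono) auto
    finally show ?thesis .
  qed
  show ?est
  proof (cases "X = 0")
    case True
    then show ?thesis using E0 by (simp flip: X_def E_def)
  next
    case False
    then have Xp: "X > 0" using X0 by simp
    have "(\<Prod>i\<in>J. integral\<^sup>L (M \<Otimes>\<^sub>M M) (T i) powr w i)
        \<le> (X * E) powr w 0 * ((X * A) powr w 1 * ((E * A) powr w 2 * (X * A) powr w 3))"
      unfolding J_def using I0 I1 I2 I3 T0 w_pos
      by (simp add: less_imp_le, intro mult_mono powr_mono2 mult_nonneg_nonneg)
         (auto simp: less_imp_le)
    also have "\<dots> = X powr (w 0 + w 1 + w 3) * E powr (w 0 + w 2) * A powr (w 1 + w 2 + w 3)"
      using Xp E0 A by (simp add: powr_mult powr_add mult_ac)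
    also have "w 0 + w 1 + w 3 = 1 - (1 - \<sigma>) / a" using a by (simp add: w_def field_simps)
    also have "w 0 + w 2 = 1 / a" using a by (simp add: w_def field_simps)
    also have "w 1 + w 2 + w 3 = 1 - \<sigma> / a" using a by (simp add: w_def field_simps)
    finally have "X \<le> C * (X powr (1 - (1 - \<sigma>) / a) * E powr (1 / a) * A powr (1 - \<sigma> / a))"
      using Xle C by (meson mult_left_mono order_trans)
    \<comment> \<open>Division by a power of \<open>X\<close>, possible because \<open>X\<close> is
      a finite positive number. The power \<open>(1 - \<sigma>) / a\<close> that survives matches
      the \<open>1 / a\<close> on \<open>E\<close>, so raising to the power \<open>a\<close> makes
      the bound linear in \<open>E\<close>.\<close>
    then have "X * X powr ((1 - \<sigma>) / a - 1)
        \<le> C * (X powr (1 - (1 - \<sigma>) / a) * E powr (1 / a) * A powr (1 - \<sigma> / a)) * X powr ((1 - \<sigma>) / a - 1)"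
      by (rule mult_right_mono) simp
    also have "X * X powr ((1 - \<sigma>) / a - 1) = X powr ((1 - \<sigma>) / a)"
      using Xp by (simp add: powr_diff)
    also have "C * (X powr (1 - (1 - \<sigma>) / a) * E powr (1 / a) * A powr (1 - \<sigma> / a)) * X powr ((1 - \<sigma>) / a - 1)
        = C * E powr (1 / a) * A powr (1 - \<sigma> / a) * (X powr (1 - (1 - \<sigma>) / a) * X powr ((1 - \<sigma>) / a - 1))"
      by (simp add: mult_ac)
    also have "X powr (1 - (1 - \<sigma>) / a) * X powr ((1 - \<sigma>) / a - 1) = 1"
      using Xp by (simp flip: powr_add)
    finally have "(X powr ((1 - \<sigma>) / a)) powr a \<le> (C * E powr (1 / a) * A powr (1 - \<sigma> / a)) powr a"
      using a by (intro powr_mono2) auto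
    also have "\<dots> = C powr a * E * A powr (a - \<sigma>)"
      using a C E0 A by (simp add: powr_mult powr_powr algebra_simps)
    finally show ?thesis
      using a by (simp add: powr_powr mult_ac flip: X_def E_def)
  qed
qed

section \<open>A regularized fundamental solution on the torus\<close>

lemma grad_eq_of_GDERIV: "GDERIV f x :> g \<Longrightarrow> grad f x = g"
  by (simp add: grad_def gderiv_def frechet_derivative_at[symmetric] vec_eq_iff inner_commute[of "axis _ _"] inner_axis)

text \<open>Induction on the order, for all members of the class at once. It spares any formula for
  higher derivatives: a class closed under partial derivatives is enough.\<close>

lemma smooth_torus_coinduct:
  assumes "f \<in> S" and S: "\<And>f. f \<in> S \<Longrightarrow> torus_periodic f"
    "\<And>f x. f \<in> S \<Longrightarrow> f differentiable (at x)"
    "\<And>f i. f \<in> S \<Longrightarrow> (\<lambda>x. grad f x $ i) \<in> S"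
  shows "smooth_torus f"
proof -
  have "Ck_on k UNIV f" if "f \<in> S" for k f
    using that
  proof (induction k arbitrary: f)
    case 0
    then show ?case
      using S(2) by (auto intro!: differentiable_imp_continuous_on simp: differentiable_on_def differentiable_at_withinI)
  next
    case (Suc k)
    then show ?case using S by auto
  qed
  then show ?thesis using assms by (auto simp: smooth_torus_def Ck_torus_def)
qed

text \<open>A smooth periodic substitute for \<open>|z|\<^sup>2\<close>, which makes cutoffs and periodizations
  unnecessary; each summand equals \<open>sin\<^sup>2(\<pi> z\<^sub>i) / \<pi>\<^sup>2\<close>.\<close>

definition torus_sq :: "real ^ 'n \<Rightarrow> real"
  where "torus_sq z = (\<Sum>i\<in>UNIV. (1 - cos (2 * pi * z $ i)) / (2 * pi\<^sup>2))"

lemma torus_sq_nonneg: "torus_sq z \<ge> 0"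
  unfolding torus_sq_def by (intro sum_nonneg divide_nonneg_nonneg) auto

lemma torus_sq_minus_commute: "torus_sq (x - y) = torus_sq (y - x)"
proof -
  have "cos (2 * pi * (x - y) $ i) = cos (2 * pi * (y - x) $ i)" for i
    using cos_minus[of "2 * pi * (y - x) $ i"] by (simp add: algebra_simps)
  then show ?thesis unfolding torus_sq_def by simp
qed

lemma cos_plus_Ints:
  assumes "k \<in> \<int>" shows "cos (2 * pi * (x + k)) = cos (2 * pi * x)" "sin (2 * pi * (x + k)) = sin (2 * pi * x)"
proof -
  obtain n :: int where n: "k = of_int n" using assms by (auto elim: Ints_cases)
  have *: "2 * pi * (x + k) = 2 * pi * x + 2 * pi * of_int n"
    by (simp add: n algebra_simps)
  show "cos (2 * pi * (x + k)) = cos (2 * pi * x)" "sin (2 * pi * (x + k)) = sin (2 * pi * x)"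
    unfolding * cos_add sin_add by simp_all
qed

lemma torus_sq_periodic: "(\<And>i. k $ i \<in> \<int>) \<Longrightarrow> torus_sq (x + k) = torus_sq x"
  unfolding torus_sq_def by (simp add: cos_plus_Ints)

lemma GDERIV_vec_nth: "GDERIV (\<lambda>x. x $ i) x :> axis i (1 :: real)"
  using bounded_linear_imp_has_derivative[OF bounded_linear_vec_nth]
  by (simp add: gderiv_def inner_axis)

lemma GDERIV_sum:
  "finite I \<Longrightarrow> (\<And>i. i \<in> I \<Longrightarrow> GDERIV (f i) x :> g i) \<Longrightarrow> GDERIV (\<lambda>x. \<Sum>i\<in>I. f i x) x :> (\<Sum>i\<in>I. g i)"
  unfolding gderiv_def inner_sum_right by (intro has_derivative_sum)

lemma GDERIV_coordinate:
  assumes "(g has_real_derivative d) (at ((y - a) $ i))"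
  shows "GDERIV (\<lambda>y. g ((y - a) $ i)) y :> d *\<^sub>R axis i 1"
proof -
  have "GDERIV (\<lambda>y. (y - a) $ i) y :> axis i 1"
    using GDERIV_diff[OF GDERIV_vec_nth GDERIV_const[of "a $ i"]] by simp
  from GDERIV_DERIV_compose[OF this assms] show ?thesis .
qed

lemma GDERIV_sin: "GDERIV (\<lambda>y. sin (2 * pi * (y - a) $ i)) y :> (2 * pi * cos (2 * pi * (y - a) $ i)) *\<^sub>R axis i 1"
  by (rule GDERIV_coordinate[where g = "\<lambda>t. sin (2 * pi * t)"]) (auto intro!: derivative_eq_intros)

lemma GDERIV_cos: "GDERIV (\<lambda>y. cos (2 * pi * (y - a) $ i)) y :> (- 2 * pi * sin (2 * pi * (y - a) $ i)) *\<^sub>R axis i 1"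
  by (rule GDERIV_coordinate[where g = "\<lambda>t. cos (2 * pi * t)"]) (auto intro!: derivative_eq_intros)

lemma sum_scaleR_axis: "(\<Sum>i\<in>UNIV. f i *\<^sub>R axis i (1 :: real)) = (\<chi> i. f i)"
proof -
  have "(f i *\<^sub>R axis i (1 :: real)) $ j = (if i = j then f j else 0)" for i j
    by (auto simp: axis_def)
  then show ?thesis by (simp add: vec_eq_iff)
qed

lemma GDERIV_torus_sq:
  "GDERIV (\<lambda>y. torus_sq (y - a)) y :> (\<chi> i. sin (2 * pi * (y - a) $ i) / pi)"
proof -
  have "GDERIV (\<lambda>y. (1 - cos (2 * pi * (y - a) $ i)) / (2 * pi\<^sup>2)) y
      :> (sin (2 * pi * (y - a) $ i) / pi) *\<^sub>R axis i 1" for i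
    by (rule GDERIV_coordinate[where g = "\<lambda>t. (1 - cos (2 * pi * t)) / (2 * pi\<^sup>2)"])
       (auto intro!: derivative_eq_intros simp: power2_eq_square)
  then show ?thesis
    unfolding torus_sq_def sum_scaleR_axis[symmetric] by (intro GDERIV_sum) auto
qed

text \<open>A class containing \<open>green\<close> and closed under partial derivatives.
  Differentiating \<open>torus_sq\<close> produces sines, a real power of
  \<open>torus_sq + e\<close> produces another power times a sine, and the logarithm produces the
  power -1 times a sine. The logarithm is there for dimension 2.\<close>

inductive_set torus_algebra :: "real ^ 'n \<Rightarrow> real \<Rightarrow> (real ^ 'n \<Rightarrow> real) set" for a e where
  const: "(\<lambda>_. c) \<in> torus_algebra a e"
| sin: "(\<lambda>y. sin (2 * pi * (y - a) $ i)) \<in> torus_algebra a e"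
| cos: "(\<lambda>y. cos (2 * pi * (y - a) $ i)) \<in> torus_algebra a e"
| powr: "(\<lambda>y. (torus_sq (y - a) + e) powr p) \<in> torus_algebra a e"
| ln: "(\<lambda>y. ln (torus_sq (y - a) + e)) \<in> torus_algebra a e"
| add: "f \<in> torus_algebra a e \<Longrightarrow> g \<in> torus_algebra a e \<Longrightarrow> (\<lambda>y. f y + g y) \<in> torus_algebra a e"
| mult: "f \<in> torus_algebra a e \<Longrightarrow> g \<in> torus_algebra a e \<Longrightarrow> (\<lambda>y. f y * g y) \<in> torus_algebra a e"

lemma torus_algebra_periodic:
  fixes a :: "real ^ 'n"
  shows "f \<in> torus_algebra a e \<Longrightarrow> torus_periodic f"
proof (induction rule: torus_algebra.induct)
  have shift: "y + k - a = (y - a) + k" for y k :: "real ^ 'n" by simp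
  {
    case (sin i)
    show ?case unfolding torus_periodic_def shift by (simp add: cos_plus_Ints del: vector_minus_component)
  next
    case (cos i)
    show ?case unfolding torus_periodic_def shift by (simp add: cos_plus_Ints del: vector_minus_component)
  next
    case (powr p)
    show ?case unfolding torus_periodic_def shift by (simp add: torus_sq_periodic)
  next
    case ln
    show ?case unfolding torus_periodic_def shift by (simp add: torus_sq_periodic)
  }
qed (auto simp: torus_periodic_def)

text \<open>Since \<open>e > 0\<close>, the base \<open>torus_sq (y - a) + e\<close> is positive
  also at the lattice translates of \<open>a\<close>, so powers and logarithm are differentiable
  everywhere.\<close>

lemma torus_algebra_GDERIV:
  assumes "e > 0" "f \<in> torus_algebra a e"
  shows "\<exists>g. (\<forall>x. GDERIV f x :> g x) \<and> (\<forall>i. (\<lambda>x. g x $ i) \<in> torus_algebra a e)"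
  using assms(2)
proof (induction rule: torus_algebra.induct)
  case (const c)
  show ?case
    by (rule exI[of _ "\<lambda>_. 0"]) (auto simp: GDERIV_const intro: torus_algebra.intros)
next
  case (sin i)
  have "(\<lambda>x. 2 * pi * axis i 1 $ j * cos (2 * pi * (x - a) $ i)) \<in> torus_algebra a e" for j
    by (intro torus_algebra.intros)
  then show ?case
    by (intro exI[of _ "\<lambda>y. (2 * pi * cos (2 * pi * (y - a) $ i)) *\<^sub>R axis i 1"] conjI allI GDERIV_sin)
       (simp add: mult_ac)
next
  case (cos i)
  have "(\<lambda>x. - 2 * pi * axis i 1 $ j * sin (2 * pi * (x - a) $ i)) \<in> torus_algebra a e" for j
    by (intro torus_algebra.intros)
  then show ?case
    by (intro exI[of _ "\<lambda>y. (- 2 * pi * sin (2 * pi * (y - a) $ i)) *\<^sub>R axis i 1"] conjI allI GDERIV_cos)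
       (simp add: mult_ac)
next
  case (powr p)
  have pos: "torus_sq z + e > 0" for z using assms torus_sq_nonneg[of z] by simp
  have ne: "torus_sq z + e \<noteq> 0" for z using pos[of z] by linarith
  have "GDERIV (\<lambda>y. (torus_sq (y - a) + e) powr p) y
      :> (p * (torus_sq (y - a) + e) powr (p - 1)) *\<^sub>R (\<chi> i. sin (2 * pi * (y - a) $ i) / pi)" for y
    by (rule GDERIV_DERIV_compose[OF GDERIV_torus_sq, where g = "\<lambda>t. (t + e) powr p"])
       (use pos ne in \<open>auto intro!: derivative_eq_intros\<close>)
  moreover have "(\<lambda>y. (p * (torus_sq (y - a) + e) powr (p - 1)) * (sin (2 * pi * (y - a) $ i) * (1 / pi)))
      \<in> torus_algebra a e" for i
    by (intro torus_algebra.intros)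
  ultimately show ?case
    by (intro exI[of _ "\<lambda>y. (p * (torus_sq (y - a) + e) powr (p - 1)) *\<^sub>R (\<chi> i. sin (2 * pi * (y - a) $ i) / pi)"])
       simp
next
  case ln
  have pos: "torus_sq z + e > 0" for z using assms torus_sq_nonneg[of z] by simp
  have ne: "torus_sq z + e \<noteq> 0" for z using pos[of z] by linarith
  have "GDERIV (\<lambda>y. ln (torus_sq (y - a) + e)) y
      :> ((torus_sq (y - a) + e) powr (- 1)) *\<^sub>R (\<chi> i. sin (2 * pi * (y - a) $ i) / pi)" for y
    by (rule GDERIV_DERIV_compose[OF GDERIV_torus_sq, where g = "\<lambda>t. ln (t + e)"])
       (use pos ne in \<open>auto intro!: derivative_eq_intros simp: powr_minus_divide abs_of_pos[OF pos]\<close>)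
  moreover have "(\<lambda>y. ((torus_sq (y - a) + e) powr (- 1)) * (sin (2 * pi * (y - a) $ i) * (1 / pi)))
      \<in> torus_algebra a e" for i
    by (intro torus_algebra.intros)
  ultimately show ?case
    by (intro exI[of _ "\<lambda>y. ((torus_sq (y - a) + e) powr (- 1)) *\<^sub>R (\<chi> i. sin (2 * pi * (y - a) $ i) / pi)"])
       simp
next
  case (add f g)
  then obtain f' g' where "\<forall>x. GDERIV f x :> f' x" "\<forall>x. GDERIV g x :> g' x"
    "\<forall>i. (\<lambda>x. f' x $ i) \<in> torus_algebra a e" "\<forall>i. (\<lambda>x. g' x $ i) \<in> torus_algebra a e" by blast
  then show ?case
    by (intro exI[of _ "\<lambda>x. f' x + g' x"]) (auto intro!: GDERIV_add torus_algebra.intros)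
next
  case (mult f g)
  then obtain f' g' where "\<forall>x. GDERIV f x :> f' x" "\<forall>x. GDERIV g x :> g' x"
    "\<forall>i. (\<lambda>x. f' x $ i) \<in> torus_algebra a e" "\<forall>i. (\<lambda>x. g' x $ i) \<in> torus_algebra a e" by blast
  then show ?case using mult.hyps
    by (intro exI[of _ "\<lambda>x. f x *\<^sub>R g' x + g x *\<^sub>R f' x"]) (auto intro!: GDERIV_mult torus_algebra.intros)
qed

lemma torus_algebra_smooth:
  assumes "e > 0" "f \<in> torus_algebra a e" shows "smooth_torus f"
proof (rule smooth_torus_coinduct[of f "torus_algebra a e"])
  fix f :: "real ^ 'a \<Rightarrow> real" assume f: "f \<in> torus_algebra a e"
  then obtain g where g: "\<forall>x. GDERIV f x :> g x" "\<forall>i. (\<lambda>x. g x $ i) \<in> torus_algebra a e"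
    using torus_algebra_GDERIV[OF assms(1)] by blast
  show "torus_periodic f" using f by (rule torus_algebra_periodic)
  show "f differentiable (at x)" for x
    using g(1) by (auto simp: gderiv_def differentiable_def)
  have "grad f = g" using g(1) grad_eq_of_GDERIV by blast
  then show "(\<lambda>x. grad f x $ i) \<in> torus_algebra a e" for i
    using g(2) by simp
qed fact

text \<open>A regularized fundamental solution: with \<open>s = torus_sq (y - a)\<close>, it is the primitive in \<open>s\<close>
  of \<open>(s + e)\<close> to the power \<open>- N / 2\<close>, divided by 2. Its Laplacian is, up to lower-order terms,
  \<open>N e\<close> times \<open>(s + e)\<close> to the power \<open>- N / 2 - 1\<close>, which concentrates at \<open>a\<close> at scale \<open>sqrt e\<close>.\<close>

definition green :: "real \<Rightarrow> real ^ 'n \<Rightarrow> real ^ 'n \<Rightarrow> real"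
  where "green e a y = (if CARD('n) = 2 then 1 / 2 * ln (torus_sq (y - a) + e)
    else 1 / (2 - real CARD('n)) * (torus_sq (y - a) + e) powr (1 - real CARD('n) / 2))"

lemma smooth_torus_green: "e > 0 \<Longrightarrow> smooth_torus (green e a :: real ^ 'n \<Rightarrow> real)"
proof -
  assume e: "e > 0"
  have "green e a \<in> torus_algebra a e"
  proof (cases "CARD('n) = 2")
    case True
    then have "green e a = (\<lambda>y. 1 / 2 * ln (torus_sq (y - a) + e))"
      unfolding green_def by presburger
    then show ?thesis by (simp only:) (intro torus_algebra.intros)
  next
    case False
    then have "green e a = (\<lambda>y. 1 / (2 - real CARD('n)) * (torus_sq (y - a) + e) powr (1 - real CARD('n) / 2))"
      unfolding green_def by presburger
    then show ?thesis by (simp only:) (intro torus_algebra.intros)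
  qed
  with e show ?thesis by (rule torus_algebra_smooth)
qed

text \<open>Both branches of \<open>green\<close> have the same derivative with respect to
  \<open>torus_sq\<close>, so dimension 2 is no longer special from here on.\<close>

lemma grad_green:
  fixes a y :: "real ^ 'n"
  assumes "e > 0"
  shows "grad (green e a) y = (\<chi> i. 1 / 2 * (torus_sq (y - a) + e) powr (- real CARD('n) / 2)
    * (sin (2 * pi * (y - a) $ i) / pi))"
proof -
  have pos: "torus_sq (y - a) + e > 0" using assms torus_sq_nonneg[of "y - a"] by simp
  define G where "G t = (if CARD('n) = 2 then 1 / 2 * ln (t + e)
    else 1 / (2 - real CARD('n)) * (t + e) powr (1 - real CARD('n) / 2))" for t
  have "(G has_real_derivative 1 / 2 * (torus_sq (y - a) + e) powr (- real CARD('n) / 2)) (at (torus_sq (y - a)))"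
  proof (cases "CARD('n) = 2")
    case True
    then have "G = (\<lambda>t. 1 / 2 * ln (t + e))" by (auto simp: G_def)
    then show ?thesis using pos True
      by (auto intro!: derivative_eq_intros simp: powr_minus_divide field_simps)
  next
    case False
    then have G: "G = (\<lambda>t. 1 / (2 - real CARD('n)) * (t + e) powr (1 - real CARD('n) / 2))" by (auto simp: G_def)
    from False have "2 - real CARD('n) \<noteq> 0" by linarith
    then show ?thesis using pos unfolding G
      by (auto intro!: derivative_eq_intros simp: divide_simps)
  qed
  from GDERIV_DERIV_compose[OF GDERIV_torus_sq this]
  show ?thesis
    by (intro grad_eq_of_GDERIV) (simp add: G_def green_def[abs_def] scaleR_vec_def mult.commute)
qed

lemma laplace_green_term:
  fixes a y :: "real ^ 'n"
  assumes "e > 0"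
  defines "\<tau> \<equiv> torus_sq (y - a) + e"
  shows "grad (\<lambda>y. grad (green e a) y $ i) y $ i =
    \<tau> powr (- real CARD('n) / 2) * cos (2 * pi * (y - a) $ i)
    - real CARD('n) / 4 * \<tau> powr (- real CARD('n) / 2 - 1) * (sin (2 * pi * (y - a) $ i) / pi)\<^sup>2"
proof -
  have pos: "\<tau> > 0" using assms torus_sq_nonneg[of "y - a"] by simp
  have 1: "GDERIV (\<lambda>y. 1 / 2 * (torus_sq (y - a) + e) powr (- real CARD('n) / 2)) y
      :> (1 / 2 * (- real CARD('n) / 2 * \<tau> powr (- real CARD('n) / 2 - 1))) *\<^sub>R (\<chi> i. sin (2 * pi * (y - a) $ i) / pi)"
    by (rule GDERIV_DERIV_compose[OF GDERIV_torus_sq, where g = "\<lambda>t. 1 / 2 * (t + e) powr (- real CARD('n) / 2)"])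
       (use pos in \<open>auto intro!: derivative_eq_intros simp: \<tau>_def\<close>)
  have 2: "GDERIV (\<lambda>y. sin (2 * pi * (y - a) $ i) / pi) y :> (2 * cos (2 * pi * (y - a) $ i)) *\<^sub>R axis i 1"
    by (rule GDERIV_coordinate[where g = "\<lambda>t. sin (2 * pi * t) / pi"])
       (auto intro!: derivative_eq_intros)
  have "grad (\<lambda>y. grad (green e a) y $ i) y
      = grad (\<lambda>y. 1 / 2 * (torus_sq (y - a) + e) powr (- real CARD('n) / 2) * (sin (2 * pi * (y - a) $ i) / pi)) y"
    by (simp only: grad_green[OF assms(1)] vec_lambda_beta)
  also note grad_eq_of_GDERIV[OF GDERIV_mult[OF 1 2]]
  finally show ?thesis
    by (simp add: \<tau>_def power2_eq_square axis_def mult_ac)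
qed

lemma torus_sq_term_le: "(1 - cos (2 * pi * t)) / (2 * pi\<^sup>2) \<le> t\<^sup>2"
proof -
  have "(sin (pi * t))\<^sup>2 \<le> (pi * t)\<^sup>2"
    using abs_sin_x_le_abs_x[of "pi * t"] by (simp add: abs_le_square_iff)
  then show ?thesis
    using cos_double_sin[of "pi * t"] by (simp add: field_simps power_mult_distrib)
qed

lemma torus_sq_le_card: "torus_sq (z :: real ^ 'n) \<le> real CARD('n)"
proof -
  have "(1 - cos (2 * pi * z $ i)) / (2 * pi\<^sup>2) \<le> 1" for i
  proof -
    have "1 - cos (2 * pi * z $ i) \<le> 2" using cos_ge_minus_one[of "2 * pi * z $ i"] by linarith
    also have "\<dots> \<le> 2 * pi\<^sup>2" using pi_gt3 by (simp add: power2_eq_square mult_ge1_I)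
    finally show ?thesis by simp
  qed
  then have "torus_sq z \<le> (\<Sum>i\<in>(UNIV :: 'n set). 1)" unfolding torus_sq_def by (rule sum_mono)
  then show ?thesis by simp
qed

text \<open>The periodic counterpart of \<open>|\<nabla>|z|^2|^2 = 4 |z|^2\<close>, as the summands
  on the left are the squared partial derivatives of \<open>torus_sq\<close>. It follows from
  \<open>sin^2 = (1 - cos) (1 + cos)\<close>, whose last factor is at most 2.\<close>

lemma sum_sin_sq_le: "(\<Sum>i\<in>UNIV. (sin (2 * pi * z $ i) / pi)\<^sup>2) \<le> 4 * torus_sq z"
proof -
  have "(sin (2 * pi * t) / pi)\<^sup>2 \<le> 4 * ((1 - cos (2 * pi * t)) / (2 * pi\<^sup>2))" for t
  proof -
    have "(sin (2 * pi * t))\<^sup>2 = (1 - cos (2 * pi * t)) * (1 + cos (2 * pi * t))"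
      by (simp add: sin_squared_eq power2_eq_square algebra_simps)
    also have "\<dots> \<le> (1 - cos (2 * pi * t)) * 2" by (intro mult_left_mono) auto
    finally show ?thesis by (simp add: field_simps)
  qed
  then show ?thesis unfolding torus_sq_def sum_distrib_left by (intro sum_mono)
qed

text \<open>Twice the left-hand side is the Laplacian of \<open>torus_sq\<close>. The deviation from
  the Euclidean value \<open>2 N\<close> is proportional to \<open>torus_sq\<close> and is the
  source of the lower-order term below.\<close>

lemma sum_cos_eq: "(\<Sum>i\<in>UNIV. cos (2 * pi * (z :: real ^ 'n) $ i)) = real CARD('n) - 2 * pi\<^sup>2 * torus_sq z"
  unfolding torus_sq_def sum_distrib_left by (simp add: sum_subtractf)

text \<open>With \<open>P = \<tau> powr (- N / 2 - 1)\<close> the leading terms combine to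
  \<open>N (s + e) P - N s P = N e P\<close>, as in the Euclidean computation; the loss comes from
  \<open>sum_cos_eq\<close>. A lower bound suffices because it will be integrated against a
  nonnegative density.\<close>

lemma laplace_green_ge:
  fixes a y :: "real ^ 'n" and e :: real
  assumes "e > 0"
  defines "\<tau> \<equiv> torus_sq (y - a) + e"
  shows "real CARD('n) * e * \<tau> powr (- real CARD('n) / 2 - 1) - 2 * pi\<^sup>2 * (torus_sq (y - a) * \<tau> powr (- real CARD('n) / 2))
    \<le> (\<Sum>i\<in>UNIV. grad (\<lambda>y. grad (green e a) y $ i) y $ i)"
proof -
  define s where "s = torus_sq (y - a)"
  have pos: "\<tau> > 0" using assms torus_sq_nonneg[of "y - a"] by simp
  define n where "n = real CARD('n)"
  define P where "P = \<tau> powr (- n / 2 - 1)"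
  have P: "P \<ge> 0" by (simp add: P_def)
  have Pt: "\<tau> powr (- n / 2) = P * (s + e)"
    using pos powr_mult_base[of \<tau> "- n / 2 - 1"] by (simp add: P_def \<tau>_def s_def mult.commute)
  have "(\<Sum>i\<in>UNIV. grad (\<lambda>y. grad (green e a) y $ i) y $ i)
      = \<tau> powr (- n / 2) * (n - 2 * pi\<^sup>2 * s) - n / 4 * P * (\<Sum>i\<in>UNIV. (sin (2 * pi * (y - a) $ i) / pi)\<^sup>2)"
    unfolding laplace_green_term[OF assms(1)]
    by (simp only: sum_subtractf sum_distrib_left[symmetric] sum_cos_eq n_def s_def P_def \<tau>_def)
  moreover have "n / 4 * P * (\<Sum>i\<in>UNIV. (sin (2 * pi * (y - a) $ i) / pi)\<^sup>2) \<le> n / 4 * P * (4 * s)"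
    unfolding s_def using P by (intro mult_left_mono sum_sin_sq_le) (auto simp: n_def)
  ultimately have "\<tau> powr (- n / 2) * (n - 2 * pi\<^sup>2 * s) - n / 4 * P * (4 * s)
      \<le> (\<Sum>i\<in>UNIV. grad (\<lambda>y. grad (green e a) y $ i) y $ i)" by linarith
  moreover have "\<tau> powr (- n / 2) * (n - 2 * pi\<^sup>2 * s) - n / 4 * P * (4 * s)
      = n * e * P - 2 * pi\<^sup>2 * (s * \<tau> powr (- n / 2))"
    unfolding Pt by (simp add: algebra_simps)
  ultimately show ?thesis by (simp add: n_def P_def s_def)
qed

lemma norm_grad_green_le:
  fixes a y :: "real ^ 'n"
  assumes "e > 0"
  shows "norm (grad (green e a) y) \<le> sqrt (torus_sq (y - a)) * (torus_sq (y - a) + e) powr (- real CARD('n) / 2)"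
proof -
  define c where "c = 1 / 2 * (torus_sq (y - a) + e) powr (- real CARD('n) / 2)"
  have c: "c \<ge> 0" by (simp add: c_def)
  have "grad (green e a) y = c *\<^sub>R (\<chi> i. sin (2 * pi * (y - a) $ i) / pi)"
    unfolding grad_green[OF assms] c_def by (simp add: vec_eq_iff)
  moreover have "norm (\<chi> i. sin (2 * pi * (y - a) $ i) / pi) \<le> sqrt (4 * torus_sq (y - a))"
    using sum_sin_sq_le[of "y - a"] unfolding norm_vec_def L2_set_def by (simp add: power_divide)
  ultimately have "norm (grad (green e a) y) \<le> c * sqrt (4 * torus_sq (y - a))"
    using c by (simp add: mult_left_mono)
  then show ?thesis by (simp add: c_def real_sqrt_mult mult_ac)
qed

text \<open>Vanishes (instead of being infinite) on the lattice, since \<open>0 powr p = 0\<close>.\<close>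

definition torus_kernel :: "real ^ 'n \<Rightarrow> real"
  where "torus_kernel z = torus_sq z powr ((1 - real CARD('n)) / 2)"

lemma torus_kernel_minus_commute: "torus_kernel (x - y) = torus_kernel (y - x)"
  by (simp add: torus_kernel_def torus_sq_minus_commute[of x y])

lemma torus_kernel_nonneg: "torus_kernel z \<ge> 0"
  by (simp add: torus_kernel_def)

text \<open>Here the regularization disappears: the bounds do not depend on \<open>e\<close>. The
  first serves the gradient of \<open>green\<close>, the second the lower-order term of its
  Laplacian. The latter is less singular by a factor \<open>sqrt (torus_sq z)\<close>, which is
  bounded. Where \<open>torus_sq z = 0\<close> both sides vanish.\<close>

lemma sqrt_torus_sq_le_kernel:
  fixes z :: "real ^ 'n"
  assumes "e > 0"
  shows "sqrt (torus_sq z) * (torus_sq z + e) powr (- real CARD('n) / 2) \<le> torus_kernel z"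
    and "torus_sq z * (torus_sq z + e) powr (- real CARD('n) / 2) \<le> real CARD('n) * torus_kernel z"
proof -
  show *: "sqrt (torus_sq z) * (torus_sq z + e) powr (- real CARD('n) / 2) \<le> torus_kernel z"
  proof (cases "torus_sq z = 0")
    case False
    then have pos: "torus_sq z > 0" using torus_sq_nonneg[of z] by simp
    have "(torus_sq z + e) powr (- real CARD('n) / 2) \<le> torus_sq z powr (- real CARD('n) / 2)"
      using pos assms by (intro powr_mono2') auto
    then have "sqrt (torus_sq z) * (torus_sq z + e) powr (- real CARD('n) / 2)
        \<le> torus_sq z powr (1 / 2) * torus_sq z powr (- real CARD('n) / 2)"
      using pos by (simp add: powr_half_sqrt mult_left_mono)
    also have "\<dots> = torus_kernel z"
    proof -
      have "1 / 2 + - real CARD('n) / 2 = (1 - real CARD('n)) / 2" by (simp add: field_simps)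
      then show ?thesis by (simp only: torus_kernel_def powr_add[symmetric])
    qed
    finally show ?thesis .
  qed (simp add: torus_kernel_nonneg)
  have "torus_sq z * (torus_sq z + e) powr (- real CARD('n) / 2)
      = sqrt (torus_sq z) * (sqrt (torus_sq z) * (torus_sq z + e) powr (- real CARD('n) / 2))"
    using torus_sq_nonneg[of z] by (simp flip: mult.assoc)
  also have "\<dots> \<le> sqrt (real CARD('n)) * torus_kernel z"
    using * torus_sq_le_card[of z] torus_sq_nonneg[of z] by (intro mult_mono) auto
  also have "\<dots> \<le> real CARD('n) * torus_kernel z"
  proof (intro mult_right_mono torus_kernel_nonneg)
    have "1 \<le> real CARD('n)" by (simp add: Suc_le_eq)
    then show "sqrt (real CARD('n)) \<le> real CARD('n)"
      by (intro real_le_lsqrt) (auto simp: power2_eq_square)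
  qed
  finally show "torus_sq z * (torus_sq z + e) powr (- real CARD('n) / 2) \<le> real CARD('n) * torus_kernel z" .
qed

section \<open>Integration on the torus and the equation with both derivatives on the test
  function\<close>

lemma borel_measurable_torus: "f \<in> borel_measurable borel \<Longrightarrow> f \<in> borel_measurable torus_measure"
  by (intro measurable_restrict_space1 measurable_completion) simp

lemma continuous_bounded_torus:
  fixes g :: "real ^ 'n \<Rightarrow> real"
  assumes "continuous_on UNIV g"
  obtains K where "\<And>x. x \<in> space torus_measure \<Longrightarrow> \<bar>g x\<bar> \<le> K"
proof -
  have "compact (g ` cbox 0 One)"
    by (intro compact_continuous_image continuous_on_subset[OF assms]) auto
  then obtain K where "\<And>x. x \<in> cbox 0 One \<Longrightarrow> norm (g x) \<le> K"
    using compact_imp_bounded[of "g ` cbox 0 One"] unfolding bounded_iff by (meson imageI)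
  then show ?thesis by (intro that[of K]) (simp add: space_restrict_space)
qed

lemma integrable_torus_mult_continuous:
  fixes f g :: "real ^ 'n \<Rightarrow> real"
  assumes "integrable torus_measure f" "continuous_on UNIV g"
  shows "integrable torus_measure (\<lambda>x. f x * g x)"
proof -
  obtain K where K: "\<And>x. x \<in> space torus_measure \<Longrightarrow> \<bar>g x\<bar> \<le> K"
    using continuous_bounded_torus[OF assms(2)] by blast
  have [measurable]: "g \<in> borel_measurable torus_measure"
    by (intro borel_measurable_torus borel_measurable_continuous_onI assms(2))
  have [measurable]: "f \<in> borel_measurable torus_measure" using assms(1) by auto
  show ?thesis
  proof (rule Bochner_Integration.integrable_bound)
    show "integrable torus_measure (\<lambda>x. K * f x)" using assms(1) by simp
    show "AE x in torus_measure. norm (f x * g x) \<le> norm (K * f x)"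
    proof (rule AE_I2)
      fix x :: "real ^ 'n" assume "x \<in> space torus_measure"
      then have "norm (g x) \<le> \<bar>K\<bar>" using K[of x] by auto
      then show "norm (f x * g x) \<le> norm (K * f x)"
        using mult_left_mono[of "\<bar>g x\<bar>" "\<bar>K\<bar>" "\<bar>f x\<bar>"] by (simp add: abs_mult mult.commute)
    qed
  qed measurable
qed

lemma grad_periodic:
  fixes f :: "real ^ 'n \<Rightarrow> real"
  assumes "torus_periodic f" "\<And>x. f differentiable (at x)"
  shows "torus_periodic (grad f)"
  unfolding torus_periodic_def
proof (intro allI impI)
  fix x k :: "real ^ 'n" assume k: "\<forall>i. k $ i \<in> \<int>"
  have f: "(f has_derivative frechet_derivative f (at (x + k))) (at (x + k))"
    using assms(2) frechet_derivative_works by blast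
  have "((\<lambda>x. x + k) has_derivative (\<lambda>h. h)) (at x)"
    by (auto intro!: derivative_eq_intros)
  from has_derivative_compose[OF this f]
  have "((\<lambda>x. f (x + k)) has_derivative frechet_derivative f (at (x + k))) (at x)" .
  moreover have "(\<lambda>x. f (x + k)) = f" using assms(1) k by (intro ext) (simp add: torus_periodic_def)
  ultimately have "(f has_derivative frechet_derivative f (at (x + k))) (at x)" by (simp only:)
  then have "frechet_derivative f (at (x + k)) = frechet_derivative f (at x)"
    by (rule frechet_derivative_at)
  then show "grad f (x + k) = grad f x" by (simp add: grad_def)
qed

lemma smooth_torus_differentiable: "smooth_torus f \<Longrightarrow> f differentiable (at x)"
proof -
  assume "smooth_torus f"
  then have "Ck_on (Suc 0) UNIV f" unfolding smooth_torus_def Ck_torus_def by blast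
  then show ?thesis by simp
qed

lemma smooth_torus_grad:
  assumes "smooth_torus f" shows "smooth_torus (\<lambda>x. grad f x $ i)"
proof -
  have "torus_periodic (grad f)"
    using assms by (intro grad_periodic smooth_torus_differentiable) (auto simp: smooth_torus_def Ck_torus_def)
  then have "torus_periodic (\<lambda>x. grad f x $ i)" by (simp add: torus_periodic_def)
  moreover have "Ck_on k UNIV (\<lambda>x. grad f x $ i)" for k
  proof -
    have "Ck_on (Suc k) UNIV f" using assms unfolding smooth_torus_def Ck_torus_def by blast
    then show ?thesis by simp
  qed
  ultimately show ?thesis by (simp add: smooth_torus_def Ck_torus_def)
qed

lemma smooth_torus_continuous: "smooth_torus f \<Longrightarrow> continuous_on UNIV f"
proof -
  assume "smooth_torus f"
  then have "Ck_on 0 UNIV f" unfolding smooth_torus_def Ck_torus_def by blast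
  then show ?thesis by simp
qed

lemma continuous_on_grad:
  "(\<And>i. continuous_on S (\<lambda>x. grad f x $ i)) \<Longrightarrow> continuous_on S (grad f)"
  unfolding continuous_on_def by (auto intro!: vec_tendstoI)

lemma integrable_of_Lp_torus_1:
  fixes f :: "real ^ 'n \<Rightarrow> 'b::euclidean_space"
  assumes "Lp_torus 1 f" shows "integrable torus_measure f"
proof -
  have "integrable torus_measure (\<lambda>x. norm (f x))" using assms by (simp add: Lp_torus_def)
  then show ?thesis using assms by (subst integrable_norm_iff[symmetric]) (auto simp: Lp_torus_def)
qed

lemma has_weak_grad_weak_grad: "W12_torus m \<Longrightarrow> has_weak_grad m (weak_grad m)"
  unfolding W12_torus_def weak_grad_def by (metis someI_ex)

text \<open>The partial derivatives of \<open>\<phi>\<close> are themselves admissible in the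
  definition of the weak gradient, so a second integration by parts is available. The result
  involves \<open>m\<close> only through its values, which is what a potential estimate
  needs.\<close>

lemma weak_solution_laplace:
  fixes m u :: "real ^ 'n \<Rightarrow> real"
  assumes m: "W12_torus m" and sol: "weak_solution H u m"
    and b: "continuous_on UNIV (\<lambda>x. grad H (grad u x))" and \<phi>: "smooth_torus \<phi>"
  shows "(\<integral>x. m x * (\<Sum>i\<in>UNIV. grad (\<lambda>y. grad \<phi> y $ i) x $ i) \<partial>torus_measure)
    = (\<integral>x. m x * (grad H (grad u x) \<bullet> grad \<phi> x) \<partial>torus_measure)"
proof -
  let ?g = "weak_grad m"
  have wg: "has_weak_grad m ?g" using m by (rule has_weak_grad_weak_grad)
  have mint: "integrable torus_measure m" and gint: "integrable torus_measure ?g"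
    using wg by (auto simp: has_weak_grad_def intro: integrable_of_Lp_torus_1)
  have cont: "continuous_on UNIV (\<lambda>y. grad \<phi> y $ i)" for i
    using \<phi> by (intro smooth_torus_continuous smooth_torus_grad)
  have cont2: "continuous_on UNIV (\<lambda>y. grad (\<lambda>y. grad \<phi> y $ i) y $ i)" for i
    using \<phi> by (intro smooth_torus_continuous smooth_torus_grad)
  have gi: "integrable torus_measure (\<lambda>x. ?g x $ i)" for i
    using integrable_bounded_linear[OF bounded_linear_vec_nth gint] .
  have gphi: "integrable torus_measure (\<lambda>x. ?g x \<bullet> grad \<phi> x)"
    unfolding inner_vec_def inner_real_def
    by (intro Bochner_Integration.integrable_sum integrable_torus_mult_continuous gi cont)
  have bphi: "integrable torus_measure (\<lambda>x. m x * (grad H (grad u x) \<bullet> grad \<phi> x))"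
    using b cont by (intro integrable_torus_mult_continuous mint continuous_on_inner continuous_on_grad) auto
  have "(\<integral>x. m x * (\<Sum>i\<in>UNIV. grad (\<lambda>y. grad \<phi> y $ i) x $ i) \<partial>torus_measure)
      = (\<Sum>i\<in>UNIV. \<integral>x. m x * grad (\<lambda>y. grad \<phi> y $ i) x $ i \<partial>torus_measure)"
    unfolding sum_distrib_left
    by (intro Bochner_Integration.integral_sum integrable_torus_mult_continuous mint cont2)
  also have "\<dots> = (\<Sum>i\<in>UNIV. - (\<integral>x. ?g x $ i * grad \<phi> x $ i \<partial>torus_measure))"
    using wg smooth_torus_grad[OF \<phi>] unfolding has_weak_grad_def by (intro sum.cong) blast+
  also have "\<dots> = - (\<integral>x. ?g x \<bullet> grad \<phi> x \<partial>torus_measure)"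
    unfolding inner_vec_def inner_real_def sum_negf
    by (subst Bochner_Integration.integral_sum) (auto intro!: integrable_torus_mult_continuous gi cont)
  also have "\<dots> = (\<integral>x. m x * (grad H (grad u x) \<bullet> grad \<phi> x) \<partial>torus_measure)"
  proof -
    have "(\<integral>x. ?g x \<bullet> grad \<phi> x + m x * (grad H (grad u x) \<bullet> grad \<phi> x) \<partial>torus_measure) = 0"
      using sol \<phi> unfolding weak_solution_def by blast
    then show ?thesis
      using Bochner_Integration.integral_add[OF gphi bphi] by simp
  qed
  finally show ?thesis .
qed

section \<open>Pointwise bound by a potential\<close>

lemma continuous_on_torus_sq [continuous_intros]:
  fixes f :: "'a::t2_space \<Rightarrow> real ^ 'n"
  assumes "continuous_on S f" shows "continuous_on S (\<lambda>x. torus_sq (f x))"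
  unfolding torus_sq_def by (auto intro!: continuous_intros assms)

lemma torus_sq_le_of_abs_less:
  fixes z :: "real ^ 'n"
  assumes "\<And>i. \<bar>z $ i\<bar> < \<epsilon>" shows "torus_sq z \<le> real CARD('n) * \<epsilon>\<^sup>2"
proof -
  have "torus_sq z \<le> (\<Sum>i\<in>UNIV. (z $ i)\<^sup>2)"
    unfolding torus_sq_def by (intro sum_mono torus_sq_term_le)
  also have "\<dots> \<le> (\<Sum>i\<in>(UNIV :: 'n set). \<epsilon>\<^sup>2)"
  proof (rule sum_mono)
    show "(z $ i)\<^sup>2 \<le> \<epsilon>\<^sup>2" for i
      using assms[of i] by (intro abs_le_square_iff[THEN iffD1]) linarith
  qed
  finally show ?thesis by simp
qed

lemma cube_eq_box: "{y :: real ^ 'n. \<forall>i. \<bar>(y - a) $ i\<bar> < \<epsilon>} = box (a - vec \<epsilon>) (a + vec \<epsilon>)"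
  by (auto simp: set_eq_iff mem_box_cart abs_less_iff less_diff_eq diff_less_eq add.commute)

text \<open>The quotient of the two constants in \<open>average_le_potential\<close>:
  \<open>2 * pi\<^sup>2 * N\<close> from the upper bound by the kernel, and
  \<open>N (N + 1) powr (- N / 2 - 1)\<close> from the lower bound for the concentrating part of the
  Laplacian on the cube. The factor \<open>N\<close> cancels. The argument only carries the
  dimension.\<close>

definition average_const :: "'n itself \<Rightarrow> real"
  where "average_const _ = 2 * pi\<^sup>2 * (real CARD('n) + 1) powr (real CARD('n) / 2 + 1)"

lemma average_const_pos: "average_const t > 0"
  unfolding average_const_def by simp

text \<open>On the cube of half-side \<epsilon> around \<open>a\<close> the concentrating part
  \<open>D\<close> of the Laplacian of \<open>green\<close> is at least of order
  \<open>\<epsilon>\<close> to the power \<open>- N\<close>. So the integral of \<open>m * D\<close>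
  dominates an average of \<open>m\<close>. By the equation that integral equals terms that are
  bounded by the kernel uniformly in \<epsilon>.\<close>

lemma average_le_potential:
  fixes m u :: "real ^ 'n \<Rightarrow> real"
  assumes m: "W12_torus m" and sol: "weak_solution H u m"
    and b: "continuous_on UNIV (\<lambda>x. grad H (grad u x))"
    and pos: "AE x in torus_measure. m x > 0" and \<epsilon>: "\<epsilon> > 0"
  shows "(\<integral>\<^sup>+y. ennreal (max (m y) 0) * indicator {y. \<forall>i. \<bar>(y - a) $ i\<bar> < \<epsilon>} y \<partial>torus_measure)
    \<le> ennreal (average_const TYPE('n) * \<epsilon> ^ CARD('n))
      * (\<integral>\<^sup>+y. ennreal (max (m y) 0 * (norm (grad H (grad u y)) + 1) * torus_kernel (a - y)) \<partial>torus_measure)"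
proof -
  define n where "n = real CARD('n)"
  have n: "n \<ge> 1" by (simp add: n_def Suc_le_eq)
  define b where "b x = grad H (grad u x)" for x
  \<comment> \<open>The density is positive only almost everywhere; \<open>M\<close> is a version
    that is nonnegative everywhere.\<close>
  define M where "M x = max (m x) 0" for x
  \<comment> \<open>The regularized solution concentrates at the scale \<open>sqrt e\<close>, which
    is matched to the half-side of the cube.\<close>
  define e where "e = \<epsilon>\<^sup>2"
  have e: "e > 0" using \<epsilon> by (simp add: e_def)
  define \<phi> where "\<phi> = green e a"
  have \<phi>: "smooth_torus \<phi>" unfolding \<phi>_def by (rule smooth_torus_green[OF e])
  define s where "s y = torus_sq (y - a)" for y
  have s0: "s y \<ge> 0" for y by (simp add: s_def torus_sq_nonneg)
  have s_pos: "s y + e > 0" for y using s0[of y] e by simp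
  define D where "D y = n * e * (s y + e) powr (- n / 2 - 1)" for y
  define R where "R y = s y * (s y + e) powr (- n / 2)" for y
  define L where "L y = (\<Sum>i\<in>UNIV. grad (\<lambda>y. grad \<phi> y $ i) y $ i)" for y
  have cont_s: "continuous_on UNIV s" unfolding s_def by (intro continuous_intros)
  have cont_D: "continuous_on UNIV D" and cont_R: "continuous_on UNIV R"
    unfolding D_def R_def using s_pos by (auto intro!: continuous_intros cont_s simp: less_imp_neq[OF s_pos, symmetric])
  have cont_L: "continuous_on UNIV L"
    unfolding L_def using \<phi> by (intro continuous_on_sum smooth_torus_continuous smooth_torus_grad)
  have cont_g: "continuous_on UNIV (\<lambda>y. b y \<bullet> grad \<phi> y)"
    using assms(3) \<phi> unfolding b_def
    by (intro continuous_on_inner continuous_on_grad smooth_torus_continuous smooth_torus_grad) auto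
  have mint: "integrable torus_measure m"
    using has_weak_grad_weak_grad[OF m] by (auto simp: has_weak_grad_def intro: integrable_of_Lp_torus_1)
  have [measurable]: "m \<in> borel_measurable torus_measure" using mint by auto
  have M_int: "integrable torus_measure M" unfolding M_def using mint by (intro integrable_max) auto
  have M0: "M y \<ge> 0" for y by (simp add: M_def)
  have mM: "AE x in torus_measure. m x = M x"
    using pos by eventually_elim (simp add: M_def)
  have Mf: "integrable torus_measure (\<lambda>y. M y * f y)" if "continuous_on UNIV f" for f
    using M_int that by (rule integrable_torus_mult_continuous)
  have mf_eq: "(\<integral>y. m y * f y \<partial>torus_measure) = (\<integral>y. M y * f y \<partial>torus_measure)"
    if "continuous_on UNIV f" for f
  proof (rule integral_cong_AE)
    show "AE x in torus_measure. m x * f x = M x * f x" using mM by eventually_elim simp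
  qed (use integrable_torus_mult_continuous[OF mint that] Mf[OF that] in auto)
  have weak: "(\<integral>y. M y * L y \<partial>torus_measure) = (\<integral>y. M y * (b y \<bullet> grad \<phi> y) \<partial>torus_measure)"
    using weak_solution_laplace[OF m sol assms(3) \<phi>] mf_eq[OF cont_L] mf_eq[OF cont_g]
    by (simp add: L_def b_def)
  have "(\<integral>y. M y * D y \<partial>torus_measure) \<le> (\<integral>y. M y * L y + M y * (2 * pi\<^sup>2 * R y) \<partial>torus_measure)"
  proof (rule integral_mono)
    show "integrable torus_measure (\<lambda>y. M y * L y + M y * (2 * pi\<^sup>2 * R y))"
      by (intro Bochner_Integration.integrable_add Mf cont_L continuous_intros cont_R)
    show "M y * D y \<le> M y * L y + M y * (2 * pi\<^sup>2 * R y)" for y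
      using mult_left_mono[OF _ M0[of y], of "D y" "L y + 2 * pi\<^sup>2 * R y"] laplace_green_ge[OF e, of y a]
      by (simp add: L_def D_def R_def s_def \<phi>_def n_def algebra_simps)
  qed (rule Mf[OF cont_D])
  also have "\<dots> = (\<integral>y. M y * L y \<partial>torus_measure) + (\<integral>y. M y * (2 * pi\<^sup>2 * R y) \<partial>torus_measure)"
    by (intro Bochner_Integration.integral_add Mf cont_L continuous_intros cont_R)
  also have "\<dots> = (\<integral>y. M y * (b y \<bullet> grad \<phi> y) + M y * (2 * pi\<^sup>2 * R y) \<partial>torus_measure)"
    unfolding weak by (intro Bochner_Integration.integral_add[symmetric] Mf cont_g continuous_intros cont_R)
  also have "\<dots> \<le> (\<integral>y. M y * \<bar>b y \<bullet> grad \<phi> y + 2 * pi\<^sup>2 * R y\<bar> \<partial>torus_measure)"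
  proof (rule integral_mono)
    show "M y * (b y \<bullet> grad \<phi> y) + M y * (2 * pi\<^sup>2 * R y) \<le> M y * \<bar>b y \<bullet> grad \<phi> y + 2 * pi\<^sup>2 * R y\<bar>" for y
      using M0[of y] by (simp add: mult_left_mono flip: distrib_left)
    show "integrable torus_measure (\<lambda>y. M y * (b y \<bullet> grad \<phi> y) + M y * (2 * pi\<^sup>2 * R y))"
      by (intro Bochner_Integration.integrable_add Mf cont_g continuous_intros cont_R)
    show "integrable torus_measure (\<lambda>y. M y * \<bar>b y \<bullet> grad \<phi> y + 2 * pi\<^sup>2 * R y\<bar>)"
      by (intro Mf cont_g continuous_intros cont_R)
  qed
  finally have main: "(\<integral>y. M y * D y \<partial>torus_measure)
      \<le> (\<integral>y. M y * \<bar>b y \<bullet> grad \<phi> y + 2 * pi\<^sup>2 * R y\<bar> \<partial>torus_measure)" .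
  \<comment> \<open>The summand 1 beside the drift accounts for the lower-order term
    \<open>R\<close>. Since \<open>2 * pi\<^sup>2 * n \<ge> 1\<close>, the same factor can be put on
    the drift term as well.\<close>
  have bound: "\<bar>b y \<bullet> grad \<phi> y + 2 * pi\<^sup>2 * R y\<bar> \<le> 2 * pi\<^sup>2 * n * ((norm (b y) + 1) * torus_kernel (a - y))" for y
  proof -
    have pi1: "1 \<le> 2 * pi\<^sup>2" using pi_gt3 by (simp add: power2_eq_square mult_ge1_I)
    have "norm (grad \<phi> y) \<le> torus_kernel (y - a)"
      using norm_grad_green_le[OF e, of a y] sqrt_torus_sq_le_kernel(1)[OF e, of "y - a"] by (simp add: \<phi>_def)
    then have "\<bar>b y \<bullet> grad \<phi> y\<bar> \<le> norm (b y) * torus_kernel (y - a)"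
      by (meson Cauchy_Schwarz_ineq2 mult_left_mono norm_ge_zero order_trans)
    also have "\<dots> \<le> (2 * pi\<^sup>2 * n) * (norm (b y) * torus_kernel (y - a))"
    proof -
      have "1 \<le> 2 * pi\<^sup>2 * n" using mult_mono[OF pi1 n] by simp
      then show ?thesis
        using mult_right_mono[of 1 "2 * pi\<^sup>2 * n" "norm (b y) * torus_kernel (y - a)"]
          torus_kernel_nonneg[of "y - a"] by simp
    qed
    finally have 1: "\<bar>b y \<bullet> grad \<phi> y\<bar> \<le> (2 * pi\<^sup>2 * n) * (norm (b y) * torus_kernel (y - a))" .
    have "R y \<le> n * torus_kernel (y - a)"
      using sqrt_torus_sq_le_kernel(2)[OF e, of "y - a"] by (simp add: R_def s_def n_def)
    then have "2 * pi\<^sup>2 * R y \<le> 2 * pi\<^sup>2 * (n * torus_kernel (y - a))" by (intro mult_left_mono) auto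
    moreover have "2 * pi\<^sup>2 * R y \<ge> 0" using s0 by (simp add: R_def)
    ultimately have "\<bar>b y \<bullet> grad \<phi> y + 2 * pi\<^sup>2 * R y\<bar>
        \<le> (2 * pi\<^sup>2 * n) * (norm (b y) * torus_kernel (y - a)) + 2 * pi\<^sup>2 * (n * torus_kernel (y - a))"
      using 1 by linarith
    also have "\<dots> = 2 * pi\<^sup>2 * n * ((norm (b y) + 1) * torus_kernel (y - a))"
      by (simp add: algebra_simps)
    finally show ?thesis by (simp only: torus_kernel_minus_commute[of a])
  qed
  define F where "F = (\<integral>\<^sup>+y. ennreal (M y * (norm (b y) + 1) * torus_kernel (a - y)) \<partial>torus_measure)"
  define K where "K = n * (n + 1) powr (- n / 2 - 1) * (1 / \<epsilon> ^ CARD('n))"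
  have K: "K > 0" using n \<epsilon> by (simp add: K_def)
  have D_ge: "K \<le> D y" if "\<And>i. \<bar>(y - a) $ i\<bar> < \<epsilon>" for y
  proof -
    have "s y + e \<le> (n + 1) * e"
      using torus_sq_le_of_abs_less[of "y - a" \<epsilon>] that by (simp add: s_def e_def n_def algebra_simps)
    then have "((n + 1) * e) powr (- n / 2 - 1) \<le> (s y + e) powr (- n / 2 - 1)"
      using s_pos[of y] n by (intro powr_mono2') auto
    then have "n * e * ((n + 1) * e) powr (- n / 2 - 1) \<le> D y"
      unfolding D_def using n e by (intro mult_left_mono) auto
    also have "n * e * ((n + 1) * e) powr (- n / 2 - 1) = n * (n + 1) powr (- n / 2 - 1) * (e * e powr (- n / 2 - 1))"
      using n e by (simp add: powr_mult)
    also have "e * e powr (- n / 2 - 1) = e powr (- n / 2)"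
      using e powr_mult_base[of e "- n / 2 - 1"] by simp
    also have "e powr (- n / 2) = \<epsilon> powr (- n)"
      using \<epsilon> by (simp add: e_def powr_powr flip: powr_numeral)
    also have "\<dots> = 1 / \<epsilon> ^ CARD('n)"
      using \<epsilon> by (simp add: n_def powr_minus_divide powr_realpow)
    finally show ?thesis by (simp add: K_def)
  qed
  let ?I = "\<integral>\<^sup>+y. ennreal (M y) * indicator {y. \<forall>i. \<bar>(y - a) $ i\<bar> < \<epsilon>} y \<partial>torus_measure"
  have "ennreal K * ?I = (\<integral>\<^sup>+y. ennreal K * (ennreal (M y) * indicator {y. \<forall>i. \<bar>(y - a) $ i\<bar> < \<epsilon>} y) \<partial>torus_measure)"
  proof (rule nn_integral_cmult[symmetric])
    have [measurable]: "M \<in> borel_measurable torus_measure" using M_int by auto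
    have [measurable]: "indicator (box (a - vec \<epsilon>) (a + vec \<epsilon>)) \<in> borel_measurable torus_measure"
      by (rule borel_measurable_torus) simp
    show "(\<lambda>y. ennreal (M y) * indicator {y. \<forall>i. \<bar>(y - a) $ i\<bar> < \<epsilon>} y) \<in> borel_measurable torus_measure"
      unfolding cube_eq_box by measurable
  qed
  also have "\<dots> \<le> (\<integral>\<^sup>+y. ennreal (M y * D y) \<partial>torus_measure)"
  proof (rule nn_integral_mono)
    fix y :: "real ^ 'n"
    have "ennreal K * ennreal (M y) \<le> ennreal (M y * D y)" if "\<forall>i. \<bar>(y - a) $ i\<bar> < \<epsilon>"
      using D_ge[of y] that K M0[of y] by (simp add: mult.commute[of K] mult_left_mono ennreal_leI flip: ennreal_mult)
    then show "ennreal K * (ennreal (M y) * indicator {y. \<forall>i. \<bar>(y - a) $ i\<bar> < \<epsilon>} y) \<le> ennreal (M y * D y)"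
      by (auto simp: indicator_def)
  qed
  also have "\<dots> = ennreal (\<integral>y. M y * D y \<partial>torus_measure)"
    using M0 e n by (intro nn_integral_eq_integral Mf cont_D) (auto simp: D_def)
  also have "\<dots> \<le> ennreal (\<integral>y. M y * \<bar>b y \<bullet> grad \<phi> y + 2 * pi\<^sup>2 * R y\<bar> \<partial>torus_measure)"
    using main by (rule ennreal_leI)
  also have "\<dots> = (\<integral>\<^sup>+y. ennreal (M y * \<bar>b y \<bullet> grad \<phi> y + 2 * pi\<^sup>2 * R y\<bar>) \<partial>torus_measure)"
    using M0 by (intro nn_integral_eq_integral[symmetric] Mf cont_g continuous_intros cont_R) auto
  also have "\<dots> \<le> (\<integral>\<^sup>+y. ennreal (2 * pi\<^sup>2 * n) * ennreal (M y * (norm (b y) + 1) * torus_kernel (a - y)) \<partial>torus_measure)"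
  proof (rule nn_integral_mono)
    fix y :: "real ^ 'n"
    have "M y * \<bar>b y \<bullet> grad \<phi> y + 2 * pi\<^sup>2 * R y\<bar>
        \<le> (2 * pi\<^sup>2 * n) * (M y * (norm (b y) + 1) * torus_kernel (a - y))"
      using mult_left_mono[OF bound[of y] M0[of y]] by (simp add: mult_ac)
    then show "ennreal (M y * \<bar>b y \<bullet> grad \<phi> y + 2 * pi\<^sup>2 * R y\<bar>)
        \<le> ennreal (2 * pi\<^sup>2 * n) * ennreal (M y * (norm (b y) + 1) * torus_kernel (a - y))"
      using n by (subst ennreal_mult'[symmetric]) (auto intro: ennreal_leI)
  qed
  also have "\<dots> = ennreal (2 * pi\<^sup>2 * n) * F"
    unfolding F_def
  proof (rule nn_integral_cmult)
    have [measurable]: "M \<in> borel_measurable torus_measure" using M_int by auto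
    have "(\<lambda>y. norm (b y) + 1) \<in> borel_measurable borel"
      using assms(3) unfolding b_def by (intro borel_measurable_continuous_onI continuous_intros)
    then have [measurable]: "(\<lambda>y. norm (b y) + 1) \<in> borel_measurable torus_measure"
      by (rule borel_measurable_torus)
    have "(\<lambda>y. torus_sq (a - y)) \<in> borel_measurable borel"
      by (intro borel_measurable_continuous_onI continuous_intros)
    then have "(\<lambda>y. torus_kernel (a - y)) \<in> borel_measurable borel" unfolding torus_kernel_def by measurable
    then have [measurable]: "(\<lambda>y. torus_kernel (a - y)) \<in> borel_measurable torus_measure"
      by (rule borel_measurable_torus)
    show "(\<lambda>y. ennreal (M y * (norm (b y) + 1) * torus_kernel (a - y))) \<in> borel_measurable torus_measure"
      by measurable
  qed
  finally have "ennreal K * ?I \<le> ennreal (2 * pi\<^sup>2 * n) * F" .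
  then have "ennreal (1 / K) * (ennreal K * ?I) \<le> ennreal (1 / K) * (ennreal (2 * pi\<^sup>2 * n) * F)"
    by (rule mult_left_mono) simp
  moreover have "ennreal (1 / K) * (ennreal K * ?I) = ?I"
    using K by (simp flip: mult.assoc ennreal_mult)
  moreover have "ennreal (1 / K) * (ennreal (2 * pi\<^sup>2 * n) * F) = ennreal (1 / K * (2 * pi\<^sup>2 * n)) * F"
  proof -
    have "ennreal (1 / K * (2 * pi\<^sup>2 * n)) = ennreal (1 / K) * ennreal (2 * pi\<^sup>2 * n)"
      using K n by (intro ennreal_mult) auto
    then show ?thesis by (simp only: mult.assoc)
  qed
  moreover have "1 / K * (2 * pi\<^sup>2 * n) = average_const TYPE('n) * \<epsilon> ^ CARD('n)"
  proof -
    have "(n + 1) powr (- n / 2 - 1) = 1 / (n + 1) powr (n / 2 + 1)"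
      using powr_minus_divide[of "n + 1" "n / 2 + 1"] by simp
    then show ?thesis using n \<epsilon> by (simp add: K_def average_const_def n_def[symmetric] field_simps)
  qed
  ultimately show ?thesis by (simp add: F_def M_def b_def)
qed

section \<open>From averages over cubes to bounds almost everywhere\<close>

lemma finite_measure_torus: "finite_measure (torus_measure :: (real ^ 'n) measure)"
  by (intro finite_measure_lebesgue_on) simp

text \<open>The sets of \<open>torus_measure\<close> are Lebesgue sets, and the product of two such
  measures is not completed again. Functions of two variables are therefore pulled back from the
  Borel product through the identity in each variable.\<close>

lemma borel_measurable_torus_pair:
  fixes f :: "real ^ 'n \<Rightarrow> real ^ 'n \<Rightarrow> 'b::topological_space"
  assumes "(\<lambda>(x, y). f x y) \<in> borel_measurable (borel \<Otimes>\<^sub>M borel)"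
  shows "(\<lambda>(x, y). f x y) \<in> borel_measurable (torus_measure \<Otimes>\<^sub>M torus_measure)"
proof -
  have id: "(\<lambda>x. x) \<in> measurable torus_measure (borel :: (real ^ 'n) measure)"
    by (intro measurable_restrict_space1 measurable_completion) simp
  let ?T = "torus_measure :: (real ^ 'n) measure"
  have "(\<lambda>p. fst p) \<in> measurable (?T \<Otimes>\<^sub>M ?T) borel" "(\<lambda>p. snd p) \<in> measurable (?T \<Otimes>\<^sub>M ?T) borel"
    by (rule measurable_compose[OF measurable_fst id] measurable_compose[OF measurable_snd id])+
  then have "(\<lambda>p. (fst p, snd p)) \<in> measurable (?T \<Otimes>\<^sub>M ?T) (borel \<Otimes>\<^sub>M borel)"
    by (rule measurable_Pair)
  from measurable_compose[OF this assms] show ?thesis by (simp add: split_def)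
qed

lemma emeasure_cube:
  fixes a :: "real ^ 'n"
  assumes "\<epsilon> > 0" shows "emeasure lborel (box (a - vec \<epsilon>) (a + vec \<epsilon>)) = ennreal ((2 * \<epsilon>) ^ CARD('n))"
proof -
  have *: "vec \<epsilon> \<bullet> b = \<epsilon>" if "b \<in> Basis" for b :: "real ^ 'n"
    using that by (auto simp: Basis_vec_def inner_axis)
  have **: "(a + vec \<epsilon> - (a - vec \<epsilon>)) \<bullet> b = 2 * \<epsilon>" if "b \<in> Basis" for b :: "real ^ 'n"
    by (simp only: inner_diff_left inner_add_left *[OF that])
  have "emeasure lborel (box (a - vec \<epsilon>) (a + vec \<epsilon>))
      = (\<Prod>b\<in>(Basis :: (real ^ 'n) set). (a + vec \<epsilon> - (a - vec \<epsilon>)) \<bullet> b)"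
    using assms * by (intro emeasure_lborel_box) (simp add: inner_diff_left inner_add_left)
  also have "(\<Prod>b\<in>(Basis :: (real ^ 'n) set). (a + vec \<epsilon> - (a - vec \<epsilon>)) \<bullet> b) = (2 * \<epsilon>) ^ CARD('n)"
    using ** by (simp cong: prod.cong)
  finally show ?thesis .
qed

lemma compact_cubes_subset:
  fixes K :: "(real ^ 'n) set"
  assumes "compact K" "open U" "K \<subseteq> U"
  obtains \<epsilon> where "\<epsilon> > 0" "\<And>x y. y \<in> K \<Longrightarrow> \<forall>i. \<bar>(x - y) $ i\<bar> < \<epsilon> \<Longrightarrow> x \<in> U"
proof -
  obtain d where d: "d > 0" "(\<Union>x\<in>K. ball x d) \<subseteq> U"
    using compact_subset_open_imp_ball_epsilon_subset[OF assms] .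
  define \<epsilon> where "\<epsilon> = d / (real CARD('n) + 1)"
  have "\<epsilon> > 0" using d by (simp add: \<epsilon>_def)
  moreover have "x \<in> U" if "y \<in> K" "\<forall>i. \<bar>(x - y) $ i\<bar> < \<epsilon>" for x y
  proof -
    have "norm (x - y) \<le> (\<Sum>i\<in>UNIV. \<bar>(x - y) $ i\<bar>)" by (rule norm_le_l1_cart)
    also have "\<dots> \<le> (\<Sum>i\<in>(UNIV :: 'n set). \<epsilon>)" using that(2) by (intro sum_mono) (simp add: less_imp_le)
    also have "\<dots> = real CARD('n) * \<epsilon>" by simp
    also have "\<dots> < d" using d by (simp add: \<epsilon>_def field_simps)
    finally have "x \<in> ball y d" by (simp add: dist_norm norm_minus_commute)
    then show ?thesis using d that(1) by blast
  qed
  ultimately show ?thesis using that by blast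
qed

text \<open>A substitute for the Lebesgue differentiation theorem: comparing averages over small cubes
  with \<open>F\<close> compares the two measures on compact sets inside open sets.\<close>

lemma AE_le_of_average_le:
  fixes f F :: "real ^ 'n \<Rightarrow> ennreal"
  assumes f[measurable]: "f \<in> borel_measurable torus_measure" and F[measurable]: "F \<in> borel_measurable torus_measure"
    and ffin: "(\<integral>\<^sup>+y. f y \<partial>torus_measure) < \<infinity>" and Ffin: "(\<integral>\<^sup>+y. F y \<partial>torus_measure) < \<infinity>"
    and avg: "\<And>a \<epsilon>. a \<in> cbox 0 One \<Longrightarrow> \<epsilon> > 0 \<Longrightarrow>
      (\<integral>\<^sup>+y. f y * indicator {y. \<forall>i. \<bar>(y - a) $ i\<bar> < \<epsilon>} y \<partial>torus_measure) \<le> ennreal ((2 * \<epsilon>) ^ CARD('n)) * F a"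
  shows "AE x in torus_measure. f x \<le> F x"
proof -
  let ?T = "torus_measure :: (real ^ 'n) measure"
  interpret T: finite_measure ?T by (rule finite_measure_torus)
  interpret P: pair_sigma_finite ?T ?T ..
  have id[measurable]: "(\<lambda>x. x) \<in> measurable ?T borel"
    by (intro measurable_restrict_space1 measurable_completion) simp
  have ind[measurable]: "indicator E \<in> borel_measurable ?T" if "E \<in> sets borel" for E :: "(real ^ 'n) set"
    using that by (intro borel_measurable_torus) simp
  \<comment> \<open>Tonelli for \<open>f y * indicator K y * Q x y\<close>. Cubes around points of
    \<open>K\<close> stay inside \<open>U\<close> and the open unit cube, so integrating over
    \<open>x\<close> first gives exactly the volume \<open>(2 * \<epsilon>) ^ N\<close>. Integrating
    over \<open>y\<close> first gives at most the cube integral of \<open>f\<close> around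
    \<open>x\<close>, and 0 unless \<open>x\<close> lies in \<open>U\<close>.\<close>
  have compact_open: "(\<integral>\<^sup>+y. f y * indicator K y \<partial>?T) \<le> (\<integral>\<^sup>+y. F y * indicator U y \<partial>?T)"
    if K: "compact K" "K \<subseteq> box 0 One" and U: "open U" "K \<subseteq> U" for K U :: "(real ^ 'n) set"
  proof -
    obtain \<epsilon> where \<epsilon>: "\<epsilon> > 0" "\<And>x y. y \<in> K \<Longrightarrow> \<forall>i. \<bar>(x - y) $ i\<bar> < \<epsilon> \<Longrightarrow> x \<in> U \<inter> box 0 One"
      using compact_cubes_subset[of K "U \<inter> box 0 One"] K U by (metis (no_types, lifting) le_inf_iff open_Int open_box)
    have [measurable]: "K \<in> sets borel" "U \<in> sets borel" using K U by (auto intro: borel_compact)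
    define Q where "Q x y = (if \<forall>i. \<bar>(x - y) $ i\<bar> < \<epsilon> then 1 else 0 :: ennreal)" for x y :: "real ^ 'n"
    have Q: "Q x y = indicator {x. \<forall>i. \<bar>(x - y) $ i\<bar> < \<epsilon>} x" for x y by (simp add: Q_def)
    have Q': "Q x y = indicator {y. \<forall>i. \<bar>(y - x) $ i\<bar> < \<epsilon>} y" for x y
      by (simp add: Q_def abs_minus_commute)
    have "(\<lambda>(x, y). Q x y) \<in> borel_measurable (borel \<Otimes>\<^sub>M borel)"
      unfolding Q_def borel_prod
    proof -
      have "open {p :: (real ^ 'n) \<times> (real ^ 'n). \<forall>i\<in>UNIV. \<bar>(fst p - snd p) $ i\<bar> < \<epsilon>}"
        unfolding Collect_ball_eq
        by (intro open_INT ballI open_Collect_less continuous_intros) auto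
      then have "indicator {p :: (real ^ 'n) \<times> (real ^ 'n). \<forall>i\<in>UNIV. \<bar>(fst p - snd p) $ i\<bar> < \<epsilon>} \<in> borel_measurable borel"
        by simp
      then show "(\<lambda>(x, y). if \<forall>i. \<bar>(x - y) $ i\<bar> < \<epsilon> then 1 else 0 :: ennreal) \<in> borel_measurable (borel :: ((real ^ 'n) \<times> (real ^ 'n)) measure)"
        by (simp add: indicator_def[abs_def] split_def of_bool_def)
    qed
    then have Qm[measurable]: "(\<lambda>(x, y). Q x y) \<in> borel_measurable (?T \<Otimes>\<^sub>M ?T)"
      by (rule borel_measurable_torus_pair)
    have vol: "(\<integral>\<^sup>+x. Q x y \<partial>?T) = ennreal ((2 * \<epsilon>) ^ CARD('n))" if "y \<in> K" for y
    proof -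
      have sub: "box (y - vec \<epsilon>) (y + vec \<epsilon>) \<subseteq> cbox 0 One"
        using \<epsilon>(2)[OF that] box_subset_cbox unfolding cube_eq_box[symmetric] by blast
      have "(\<integral>\<^sup>+x. Q x y \<partial>?T) = emeasure ?T (box (y - vec \<epsilon>) (y + vec \<epsilon>))"
        unfolding Q cube_eq_box using sub by (intro nn_integral_indicator) (auto simp: sets_restrict_space_iff)
      also have "\<dots> = emeasure lebesgue (box (y - vec \<epsilon>) (y + vec \<epsilon>))"
        using sub by (intro emeasure_restrict_space) auto
      finally show ?thesis using emeasure_cube[OF \<epsilon>(1), of y] by simp
    qed
    have "(\<integral>\<^sup>+y. f y * indicator K y \<partial>?T) * ennreal ((2 * \<epsilon>) ^ CARD('n))
        = (\<integral>\<^sup>+y. (f y * indicator K y) * ennreal ((2 * \<epsilon>) ^ CARD('n)) \<partial>?T)"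
      by (rule nn_integral_multc[symmetric]) measurable
    also have "\<dots> = (\<integral>\<^sup>+y. (f y * indicator K y) * (\<integral>\<^sup>+x. Q x y \<partial>?T) \<partial>?T)"
      using vol by (intro nn_integral_cong) (auto simp: indicator_def)
    also have "\<dots> = (\<integral>\<^sup>+y. \<integral>\<^sup>+x. f y * indicator K y * Q x y \<partial>?T \<partial>?T)"
      by (intro nn_integral_cong nn_integral_cmult[symmetric]) measurable
    also have "\<dots> = (\<integral>\<^sup>+x. \<integral>\<^sup>+y. f y * indicator K y * Q x y \<partial>?T \<partial>?T)"
      by (rule P.Fubini') measurable
    also have "\<dots> \<le> (\<integral>\<^sup>+x. (F x * indicator U x) * ennreal ((2 * \<epsilon>) ^ CARD('n)) \<partial>?T)"
    proof (rule nn_integral_mono)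
      fix x assume x: "x \<in> space ?T"
      show "(\<integral>\<^sup>+y. f y * indicator K y * Q x y \<partial>?T) \<le> (F x * indicator U x) * ennreal ((2 * \<epsilon>) ^ CARD('n))"
      proof (cases "x \<in> U")
        case True
        have "(\<integral>\<^sup>+y. f y * indicator K y * Q x y \<partial>?T) \<le> (\<integral>\<^sup>+y. f y * indicator {y. \<forall>i. \<bar>(y - x) $ i\<bar> < \<epsilon>} y \<partial>?T)"
          by (intro nn_integral_mono) (auto simp: Q' indicator_def)
        also have "\<dots> \<le> ennreal ((2 * \<epsilon>) ^ CARD('n)) * F x"
          using x \<epsilon> by (intro avg) (auto simp: space_restrict_space)
        finally show ?thesis using True by (simp add: mult.commute)
      next
        case False
        then have "f y * indicator K y * Q x y = 0" for y
          using \<epsilon>(2)[of y x] by (auto simp: Q_def indicator_def)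
        then have "(\<integral>\<^sup>+y. f y * indicator K y * Q x y \<partial>?T) = (\<integral>\<^sup>+y. 0 \<partial>?T)"
          by (intro nn_integral_cong)
        then show ?thesis by simp
      qed
    qed
    also have "\<dots> = (\<integral>\<^sup>+x. F x * indicator U x \<partial>?T) * ennreal ((2 * \<epsilon>) ^ CARD('n))"
      by (rule nn_integral_multc) measurable
    finally have "ennreal ((2 * \<epsilon>) ^ CARD('n)) * (\<integral>\<^sup>+y. f y * indicator K y \<partial>?T)
        \<le> ennreal ((2 * \<epsilon>) ^ CARD('n)) * (\<integral>\<^sup>+x. F x * indicator U x \<partial>?T)"
      by (simp only: mult.commute)
    then show ?thesis
      using \<epsilon>(1) by (subst (asm) ennreal_mult_le_mult_iff) auto
  qed
  \<comment> \<open>Inner and outer regularity concern Borel measures, so the densities on the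
    Lebesgue sets of the cube are pushed forward to finite Borel measures on the whole
    space.\<close>
  define \<mu> where "\<mu> h = distr (density ?T h) borel (\<lambda>x. x)" for h
  have sets_\<mu>: "sets (\<mu> h) = sets borel" for h by (simp add: \<mu>_def)
  have em: "emeasure (\<mu> h) E = (\<integral>\<^sup>+y. h y * indicator E y \<partial>?T)"
    if [measurable]: "h \<in> borel_measurable ?T" "E \<in> sets borel" for h E
  proof -
    have "emeasure (\<mu> h) E = emeasure (density ?T h) (E \<inter> space ?T)"
      unfolding \<mu>_def by (subst emeasure_distr) (auto simp: measurable_cong_sets[OF sets_density refl])
    also have "\<dots> = (\<integral>\<^sup>+y. h y * indicator (E \<inter> space ?T) y \<partial>?T)"
      using measurable_sets[OF id that(2)] by (intro emeasure_density) (auto simp: Int_commute)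
    also have "\<dots> = (\<integral>\<^sup>+y. h y * indicator E y \<partial>?T)"
      by (intro nn_integral_cong) (auto simp: indicator_def)
    finally show ?thesis .
  qed
  have borel_le: "(\<integral>\<^sup>+y. f y * indicator E y \<partial>?T) \<le> (\<integral>\<^sup>+y. F y * indicator E y \<partial>?T)"
    if E: "E \<in> sets borel" "E \<subseteq> box 0 One" for E
  proof -
    have "emeasure (\<mu> f) E = (SUP K \<in> {K. K \<subseteq> E \<and> compact K}. emeasure (\<mu> f) K)"
      using em[OF f, of UNIV] ffin E by (intro inner_regular sets_\<mu>) (auto simp: \<mu>_def)
    moreover have "emeasure (\<mu> F) E = (INF U \<in> {U. E \<subseteq> U \<and> open U}. emeasure (\<mu> F) U)"
      using em[OF F, of UNIV] Ffin E by (intro outer_regular sets_\<mu>) (auto simp: \<mu>_def)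
    moreover have "emeasure (\<mu> f) K \<le> emeasure (\<mu> F) U"
      if "K \<subseteq> E" "compact K" "E \<subseteq> U" "open U" for K U
      using compact_open[of K U] that E em[OF f borel_compact] em[OF F borel_open] by auto
    ultimately have "emeasure (\<mu> f) E \<le> emeasure (\<mu> F) E"
      by (auto intro!: SUP_least INF_greatest)
    then show ?thesis using em[OF f E(1)] em[OF F E(1)] by simp
  qed
  \<comment> \<open>The exceptional set inside the open cube is only Lebesgue measurable. Its Borel
    part \<open>S\<close> misses at most a null set; on \<open>S\<close> the strict inequality
    \<open>F < f\<close> would contradict \<open>borel_le\<close>, and the boundary of the cube is
    null.\<close>
  define D where "D = {x \<in> space ?T. F x < f x} \<inter> box 0 One"
  have "{x \<in> space ?T. F x < f x} \<in> sets ?T" by measurable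
  then have "D \<in> sets lebesgue" unfolding D_def by (auto simp: sets_restrict_space_iff)
  then obtain S N N' where S: "D = S \<union> N" "N \<subseteq> N'" "N' \<in> null_sets lborel" "S \<in> sets lborel"
    by (rule sets_completionE)
  have Sb: "S \<in> sets borel" "S \<subseteq> box 0 One" using S by (auto simp: D_def)
  have "AE x in ?T. f x * indicator S x \<le> F x * indicator S x"
  proof (rule ccontr)
    assume *: "\<not> ?thesis"
    have "(\<integral>\<^sup>+y. F y * indicator S y \<partial>?T) < (\<integral>\<^sup>+y. f y * indicator S y \<partial>?T)"
    proof (rule nn_integral_less)
      have "(\<integral>\<^sup>+y. F y * indicator S y \<partial>?T) \<le> (\<integral>\<^sup>+y. F y \<partial>?T)"
        by (intro nn_integral_mono) (auto simp: indicator_def)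
      then show "(\<integral>\<^sup>+y. F y * indicator S y \<partial>?T) \<noteq> \<infinity>" using Ffin by (auto simp: top_unique)
      show "AE x in ?T. F x * indicator S x \<le> f x * indicator S x"
        using S(1) by (intro AE_I2) (auto simp: indicator_def D_def intro: less_imp_le)
    qed (use * Sb in measurable)
    then show False using borel_le[OF Sb] by simp
  qed
  moreover have "AE x in ?T. x \<notin> N'"
  proof -
    have "AE x in lebesgue. x \<notin> N'" by (intro AE_completion AE_not_in S(3))
    then show ?thesis by (subst AE_restrict_space_iff) auto
  qed
  moreover have "AE x in ?T. x \<in> box 0 One"
  proof -
    have "cbox 0 One - box 0 One \<in> null_sets (lebesgue :: (real ^ 'n) measure)"
      using negligible_frontier_interval negligible_iff_null_sets by blast
    then have "AE x in lebesgue. x \<notin> cbox 0 One - box (0 :: real ^ 'n) One" by (rule AE_not_in)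
    then show ?thesis by (subst AE_restrict_space_iff) auto
  qed
  ultimately show ?thesis
    using AE_space
  proof eventually_elim
    case (elim x)
    show ?case
    proof (rule ccontr)
      assume "\<not> f x \<le> F x"
      then have "x \<in> S" using elim S(1,2) by (auto simp: D_def not_le)
      then show False using elim \<open>\<not> f x \<le> F x\<close> by simp
    qed
  qed
qed

section \<open>Integrability of the kernel\<close>

lemma measurable_torus_kernel_diff:
  "(\<lambda>(x, y). torus_kernel (x - y :: real ^ 'n)) \<in> borel_measurable (torus_measure \<Otimes>\<^sub>M torus_measure)"
proof -
  have "continuous_on UNIV (\<lambda>p :: (real ^ 'n) \<times> (real ^ 'n). torus_sq (fst p - snd p))"
    by (intro continuous_intros)
  then have "(\<lambda>p :: (real ^ 'n) \<times> (real ^ 'n). torus_sq (fst p - snd p)) \<in> borel_measurable borel"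
    by (rule borel_measurable_continuous_onI)
  then have "(\<lambda>(x, y). torus_kernel (x - y :: real ^ 'n)) \<in> borel_measurable (borel \<Otimes>\<^sub>M borel)"
    unfolding borel_prod torus_kernel_def split_def by measurable
  then show ?thesis by (rule borel_measurable_torus_pair)
qed

lemma prod_mono_ennreal:
  fixes f g :: "'i \<Rightarrow> ennreal"
  assumes "\<And>i. i \<in> I \<Longrightarrow> f i \<le> g i" shows "prod f I \<le> prod g I"
  using assms by (induction I rule: infinite_finite_induct) (auto intro!: mult_mono)

text \<open>A form of Jordan's inequality with half the optimal constant. Up to
  \<open>pi / 3\<close> the function \<open>sin x - x / 2\<close> increases because its derivative
  is nonnegative; beyond that \<open>sin x\<close> is at least 1/2.\<close>

lemma divide_pi_le_sin:
  assumes "0 \<le> x" "x \<le> pi / 2" shows "x / pi \<le> sin x"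
proof (cases "x \<le> pi / 3")
  case True
  have "(\<lambda>x. sin x - x / 2) 0 \<le> (\<lambda>x. sin x - x / 2) x"
  proof (rule DERIV_nonneg_imp_nondecreasing[OF assms(1)])
    fix t assume t: "0 \<le> t" "t \<le> x"
    have "cos (pi / 3) \<le> cos t" using t True by (intro cos_monotone_0_pi_le) auto
    then have "cos t - 1 / 2 \<ge> 0" by (simp add: cos_60)
    moreover have "((\<lambda>x. sin x - x / 2) has_real_derivative cos t - 1 / 2) (at t)"
      by (auto intro!: derivative_eq_intros)
    ultimately show "\<exists>y. ((\<lambda>x. sin x - x / 2) has_real_derivative y) (at t) \<and> 0 \<le> y" by blast
  qed
  then have "x / 2 \<le> sin x" by simp
  moreover have "x / pi \<le> x / 2" using assms pi_gt3 by (intro divide_left_mono) auto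
  ultimately show ?thesis by linarith
next
  case False
  have "sin (pi / 6) \<le> sin x" using assms False by (intro sin_monotone_2pi_le) auto
  then have "1 / 2 \<le> sin x" by (simp add: sin_30)
  moreover have "x / pi \<le> 1 / 2" using assms by (simp add: field_simps)
  ultimately show ?thesis by linarith
qed

text \<open>Infinite at 0, so that it dominates the kernel pointwise and not only almost everywhere.\<close>

definition singular_weight :: "real \<Rightarrow> real \<Rightarrow> ennreal"
  where "singular_weight c t = (if t = 0 then top else ennreal ((\<bar>t\<bar> / pi) powr (- c)))"

lemma borel_measurable_singular_weight [measurable]: "singular_weight c \<in> borel_measurable borel"
  unfolding singular_weight_def[abs_def] by measurable

text \<open>The interval contains all differences of two points of the unit interval together with
  their translates by 1 and -1.\<close>

lemma nn_integral_singular_weight_finite: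
  assumes "c < 1"
  shows "(\<integral>\<^sup>+t. singular_weight c t * indicator {-2..2} t \<partial>lborel) < \<infinity>"
proof -
  define h where "h t = pi powr c * (if t \<in> {0..2} then t powr (- c) else 0)" for t :: real
  have h0: "h t \<ge> 0" for t by (simp add: h_def)
  have [measurable]: "h \<in> borel_measurable borel" unfolding h_def by measurable
  have "(\<lambda>t. t powr (- c)) integrable_on {0..2}" using assms by (intro integrable_on_powr_from_0) auto
  then have "(\<lambda>t. if t \<in> {0..2} then t powr (- c) else 0) integrable_on UNIV"
    by (simp only: integrable_restrict_UNIV)
  then have "h integrable_on UNIV"
    unfolding h_def by (rule integrable_on_mult_right)
  then obtain I where "(h has_integral I) UNIV" by (auto simp: integrable_on_def)
  then have hI: "(\<integral>\<^sup>+t. ennreal (h t) \<partial>lborel) = ennreal I"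
    using h0 by (intro nn_integral_has_integral_lborel) auto
  have hI': "(\<integral>\<^sup>+t. ennreal (h (- t)) \<partial>lborel) = ennreal I"
    using nn_integral_real_affine[of "\<lambda>t. ennreal (h t)" "-1" 0] hI by simp
  have "(\<integral>\<^sup>+t. singular_weight c t * indicator {-2..2} t \<partial>lborel)
      \<le> (\<integral>\<^sup>+t. ennreal (h t) + ennreal (h (- t)) \<partial>lborel)"
  proof (rule nn_integral_mono_AE)
    have "AE t in lborel. t \<noteq> (0 :: real)" by (rule AE_lborel_singleton)
    then show "AE t in lborel. singular_weight c t * indicator {-2..2} t \<le> ennreal (h t) + ennreal (h (- t))"
    proof eventually_elim
      case (elim t)
      then have "singular_weight c t = ennreal (pi powr c * \<bar>t\<bar> powr (- c))"
        by (simp add: singular_weight_def powr_divide powr_minus_divide)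
      then show ?case
        using elim by (cases "t > 0") (auto simp: h_def indicator_def intro: order_trans[OF _ add_increasing])
    qed
  qed
  also have "\<dots> = ennreal I + ennreal I"
    using hI hI' by (subst nn_integral_add) auto
  also have "\<dots> < \<infinity>" by simp
  finally show ?thesis .
qed

text \<open>One coordinate term of \<open>torus_sq\<close> vanishes on [-1, 1] at the three
  integers, and each weight is singular at one of them. For the integer nearest to \<open>t\<close>
  the distance \<open>r\<close> is at most 1/2, where \<open>sin (pi * r) \<ge> r\<close> and hence
  \<open>(r / pi)\<^sup>2 \<le> s\<close>. Allowing any larger \<open>s\<close> lets the lemma be
  used in every coordinate with the same \<open>s = torus_sq z\<close>.\<close>

lemma inverse_power_sin_le:
  assumes "\<bar>t\<bar> \<le> 1" "c \<ge> 0" "s > 0" "(1 - cos (2 * pi * t)) / (2 * pi\<^sup>2) \<le> s"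
  shows "ennreal (s powr (- c / 2)) \<le> singular_weight c t + (singular_weight c (t - 1) + singular_weight c (t + 1))"
proof -
  have bound: "ennreal (s powr (- c / 2)) \<le> singular_weight c r"
    if r: "\<bar>r\<bar> \<le> 1 / 2" "(1 - cos (2 * pi * r)) / (2 * pi\<^sup>2) \<le> s" for r
  proof (cases "r = 0")
    case False
    have "pi * \<bar>r\<bar> / pi \<le> sin (pi * \<bar>r\<bar>)" using r by (intro divide_pi_le_sin) auto
    then have "\<bar>r\<bar> \<le> sin (pi * \<bar>r\<bar>)" by simp
    then have "\<bar>r\<bar>\<^sup>2 \<le> (sin (pi * \<bar>r\<bar>))\<^sup>2" by (intro power_mono) auto
    also have "\<dots> = (sin (pi * r))\<^sup>2" by (cases "r \<ge> 0") auto
    finally have "\<bar>r\<bar>\<^sup>2 / pi\<^sup>2 \<le> (1 - cos (2 * pi * r)) / (2 * pi\<^sup>2)"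
      using cos_double_sin[of "pi * r"] by (simp add: field_simps)
    then have "(\<bar>r\<bar> / pi)\<^sup>2 \<le> s" using r by (simp add: power_divide)
    then have "s powr (- c / 2) \<le> ((\<bar>r\<bar> / pi)\<^sup>2) powr (- c / 2)"
      using assms False by (intro powr_mono2') auto
    also have "\<dots> = (\<bar>r\<bar> / pi) powr (- c)"
      using False by (simp add: powr_powr flip: powr_numeral)
    finally show ?thesis using False by (simp add: singular_weight_def ennreal_leI)
  qed (simp add: singular_weight_def)
  consider "\<bar>t\<bar> \<le> 1 / 2" | "t > 1 / 2" | "t < - 1 / 2" by linarith
  then show ?thesis
  proof cases
    case 1
    then show ?thesis using bound[of t] assms by (meson add_increasing2 zero_le)
  next
    case 2
    have "cos (2 * pi * (t - 1)) = cos (2 * pi * t)" using cos_plus_Ints(1)[of "-1" t] by simp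
    then have "ennreal (s powr (- c / 2)) \<le> singular_weight c (t - 1)"
      using 2 assms by (intro bound) auto
    then show ?thesis by (meson add_increasing add_increasing2 zero_le)
  next
    case 3
    have "cos (2 * pi * (t + 1)) = cos (2 * pi * t)" using cos_plus_Ints(1)[of 1 t] by simp
    then have "ennreal (s powr (- c / 2)) \<le> singular_weight c (t + 1)"
      using 3 assms by (intro bound) auto
    then show ?thesis by (meson add_increasing zero_le)
  qed
qed

text \<open>In place of polar coordinates, the power of the kernel is written as \<open>N\<close>
  equal factors \<open>torus_sq z powr (- c / 2)\<close>. Since \<open>torus_sq z\<close> dominates
  each of its coordinate terms, the i-th factor is bounded by a function of \<open>z $ i\<close>
  alone, and the integral splits into one-dimensional ones. These converge because
  \<open>c = q (N - 1) / N < 1\<close>, which is the hypothesis on \<open>q\<close>.\<close>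

lemma torus_kernel_powr_integral:
  assumes q: "q > 0" "q * (real CARD('n) - 1) < real CARD('n)"
  obtains A where "A > 0"
    "\<And>x :: real ^ 'n. x \<in> cbox 0 One \<Longrightarrow> (\<integral>\<^sup>+y. ennreal (torus_kernel (x - y) powr q) \<partial>torus_measure) \<le> ennreal A"
proof -
  define n where "n = real CARD('n)"
  have n: "n \<ge> 1" by (simp add: n_def Suc_le_eq)
  define c where "c = q * (n - 1) / n"
  have c: "0 \<le> c" "c < 1" using q n by (auto simp: c_def n_def[symmetric])
  define W where "W = (\<integral>\<^sup>+t. singular_weight c t * indicator {-2..2} t \<partial>lborel)"
  have W: "W < \<infinity>" unfolding W_def by (rule nn_integral_singular_weight_finite[OF c(2)])
  define w where "w t = singular_weight c t + (singular_weight c (t - 1) + singular_weight c (t + 1))" for t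
  have [measurable]: "w \<in> borel_measurable borel" unfolding w_def by measurable
  have shift: "(\<integral>\<^sup>+t. singular_weight c (p - t) * indicator {0..1} t \<partial>lborel) \<le> W" if "-1 \<le> p" "p \<le> 2" for p
  proof -
    have "(\<integral>\<^sup>+t. singular_weight c (p - t) * indicator {0..1} t \<partial>lborel)
        \<le> (\<integral>\<^sup>+t. singular_weight c (p - t) * indicator {-2..2} (p - t) \<partial>lborel)"
      using that by (intro nn_integral_mono) (auto simp: indicator_def)
    also have "\<dots> = W"
      using nn_integral_real_affine[of "\<lambda>t. singular_weight c t * indicator {-2..2} t" "-1" p] by (simp add: W_def)
    finally show ?thesis .
  qed
  have w_int: "(\<integral>\<^sup>+t. w (p - t) * indicator {0..1} t \<partial>lborel) \<le> W + (W + W)" if "0 \<le> p" "p \<le> 1" for p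
  proof -
    have "(\<integral>\<^sup>+t. w (p - t) * indicator {0..1} t \<partial>lborel)
        = (\<integral>\<^sup>+t. singular_weight c (p - t) * indicator {0..1} t + (singular_weight c ((p - 1) - t) * indicator {0..1} t
          + singular_weight c ((p + 1) - t) * indicator {0..1} t) \<partial>lborel)"
      by (intro nn_integral_cong) (simp add: w_def distrib_right algebra_simps)
    also have "\<dots> = (\<integral>\<^sup>+t. singular_weight c (p - t) * indicator {0..1} t \<partial>lborel)
        + ((\<integral>\<^sup>+t. singular_weight c ((p - 1) - t) * indicator {0..1} t \<partial>lborel)
          + (\<integral>\<^sup>+t. singular_weight c ((p + 1) - t) * indicator {0..1} t \<partial>lborel))"
      by (simp add: nn_integral_add)
    also have "\<dots> \<le> W + (W + W)" using that by (intro add_mono shift) auto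
    finally show ?thesis .
  qed
  have kernel: "ennreal (torus_kernel z powr q) \<le> (\<Prod>b\<in>Basis. w (z \<bullet> b))"
    if z: "\<And>i. \<bar>z $ i\<bar> \<le> 1" for z :: "real ^ 'n"
  proof (cases "torus_sq z = 0")
    case True
    then show ?thesis by (simp add: torus_kernel_def)
  next
    case False
    then have s: "torus_sq z > 0" using torus_sq_nonneg[of z] by simp
    have "torus_kernel z powr q = (torus_sq z powr (- c / 2)) powr n"
    proof -
      have "(1 - n) / 2 * q = - c / 2 * n" using n by (simp add: c_def field_simps)
      then show ?thesis by (simp only: torus_kernel_def powr_powr n_def[symmetric])
    qed
    also have "\<dots> = (\<Prod>b\<in>(Basis :: (real ^ 'n) set). torus_sq z powr (- c / 2))"
      using s by (simp add: n_def powr_realpow)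
    finally have "ennreal (torus_kernel z powr q) = (\<Prod>b\<in>(Basis :: (real ^ 'n) set). ennreal (torus_sq z powr (- c / 2)))"
      by (simp add: ennreal_power)
    also have "\<dots> \<le> (\<Prod>b\<in>Basis. w (z \<bullet> b))"
    proof (rule prod_mono_ennreal)
      fix b :: "real ^ 'n" assume "b \<in> Basis"
      then obtain i where b: "b = axis i 1" by (auto simp: Basis_vec_def)
      have "(1 - cos (2 * pi * z $ i)) / (2 * pi\<^sup>2) \<le> torus_sq z"
        unfolding torus_sq_def by (rule member_le_sum) auto
      then show "ennreal (torus_sq z powr (- c / 2)) \<le> w (z \<bullet> b)"
        unfolding w_def b inner_axis using inverse_power_sin_le[OF z[of i] c(1) s] by simp
    qed
    finally show ?thesis .
  qed
  have main: "(\<integral>\<^sup>+y. ennreal (torus_kernel (x - y) powr q) \<partial>torus_measure) \<le> (W + (W + W)) ^ CARD('n)"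
    if x: "x \<in> cbox 0 One" for x :: "real ^ 'n"
  proof -
    have xb: "0 \<le> x \<bullet> b" "x \<bullet> b \<le> 1" if "b \<in> Basis" for b
      using x that by (auto simp: mem_box)
    have "(\<integral>\<^sup>+y. ennreal (torus_kernel (x - y) powr q) \<partial>torus_measure)
        = (\<integral>\<^sup>+y. ennreal (torus_kernel (x - y) powr q) * indicator (cbox 0 One) y \<partial>lborel)"
      by (subst nn_integral_restrict_space) (auto simp: nn_integral_completion)
    also have "\<dots> \<le> (\<integral>\<^sup>+y. (\<Prod>b\<in>Basis. w (x \<bullet> b - y \<bullet> b) * indicator {0..1} (y \<bullet> b)) \<partial>lborel)"
    proof (rule nn_integral_mono)
      fix y :: "real ^ 'n"
      show "ennreal (torus_kernel (x - y) powr q) * indicator (cbox 0 One) y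
          \<le> (\<Prod>b\<in>Basis. w (x \<bullet> b - y \<bullet> b) * indicator {0..1} (y \<bullet> b))"
      proof (cases "y \<in> cbox 0 One")
        case True
        then have yb: "0 \<le> y \<bullet> b" "y \<bullet> b \<le> 1" if "b \<in> Basis" for b
          using that by (auto simp: mem_box)
        have "\<bar>(x - y) $ i\<bar> \<le> 1" for i
          using xb[of "axis i 1"] yb[of "axis i 1"] by (simp add: axis_in_Basis_iff inner_axis abs_le_iff)
        then have "ennreal (torus_kernel (x - y) powr q) \<le> (\<Prod>b\<in>Basis. w ((x - y) \<bullet> b))" by (rule kernel)
        also have "\<dots> = (\<Prod>b\<in>Basis. w (x \<bullet> b - y \<bullet> b) * indicator {0..1} (y \<bullet> b))"
          using yb by (intro prod.cong) (auto simp: inner_diff_left)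
        finally show ?thesis using True by simp
      qed simp
    qed
    also have "\<dots> = (\<Prod>b\<in>Basis. (\<integral>\<^sup>+t. w (x \<bullet> b - t) * indicator {0..1} t \<partial>lborel))"
      by (rule nn_integral_lborel_prod[where f = "\<lambda>b t. w (x \<bullet> b - t) * indicator {0..1} t"]) auto
    also have "\<dots> \<le> (\<Prod>b\<in>(Basis :: (real ^ 'n) set). W + (W + W))"
      using xb by (intro prod_mono_ennreal w_int)
    also have "\<dots> = (W + (W + W)) ^ CARD('n)" by simp
    finally show ?thesis .
  qed
  have fin: "(W + (W + W)) ^ CARD('n) < \<infinity>" using W by (simp add: power_less_top_ennreal)
  define A where "A = enn2real ((W + (W + W)) ^ CARD('n)) + 1"
  show thesis
  proof (rule that[of A])
    show "A > 0" by (simp add: A_def add_nonneg_pos)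
    show "(\<integral>\<^sup>+y. ennreal (torus_kernel (x - y) powr q) \<partial>torus_measure) \<le> ennreal A"
      if "x \<in> cbox 0 One" for x :: "real ^ 'n"
    proof -
      have "(W + (W + W)) ^ CARD('n) = ennreal (enn2real ((W + (W + W)) ^ CARD('n)))" using fin by simp
      also have "\<dots> \<le> ennreal A" by (intro ennreal_leI) (simp add: A_def)
      finally show ?thesis using main[OF that] by simp
    qed
  qed
qed

section \<open>The estimate on the torus\<close>

lemma continuous_on_grad_Ck:
  assumes "Ck_on (Suc k) UNIV f" shows "continuous_on UNIV (grad f)"
proof (rule continuous_on_grad)
  fix i
  have "Ck_on k UNIV (\<lambda>x. grad f x $ i)" using assms by simp
  then show "continuous_on UNIV (\<lambda>x. grad f x $ i)"
    by (cases k) (auto intro!: differentiable_imp_continuous_on simp: differentiable_on_def differentiable_at_withinI)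
qed

text \<open>Comparing the constant of \<open>average_le_potential\<close> with the volume
  \<open>(2 * \<epsilon>) ^ N\<close> of the cube leaves the denominator \<open>2 ^ N\<close>. The
  case \<open>q = 1\<close> of the kernel bound makes the potential integrable, as the passage from
  averages to points requires.\<close>

lemma kernel_inequality:
  fixes m u :: "real ^ 'n \<Rightarrow> real"
  assumes m: "W12_torus m" and sol: "weak_solution H u m"
    and b: "continuous_on UNIV (\<lambda>x. grad H (grad u x))"
    and pos: "AE x in torus_measure. m x > 0"
  shows "AE x in torus_measure. ennreal (max (m x) 0)
    \<le> ennreal (average_const TYPE('n) / 2 ^ CARD('n))
      * (\<integral>\<^sup>+y. ennreal (max (m y) 0 * (norm (grad H (grad u y)) + 1) * torus_kernel (x - y)) \<partial>torus_measure)"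
proof -
  let ?T = "torus_measure :: (real ^ 'n) measure"
  interpret T: finite_measure ?T by (rule finite_measure_torus)
  interpret P: pair_sigma_finite ?T ?T ..
  define B where "B x = norm (grad H (grad u x)) + 1" for x
  have B_cont: "continuous_on UNIV B" unfolding B_def by (intro continuous_intros b)
  have mint: "integrable ?T m"
    using has_weak_grad_weak_grad[OF m] by (auto simp: has_weak_grad_def intro: integrable_of_Lp_torus_1)
  then have max_int: "integrable ?T (\<lambda>x. max (m x) 0)" by (intro integrable_max) auto
  define f where "f x = max (m x) 0 * B x" for x
  have f_int: "integrable ?T f"
    unfolding f_def by (rule integrable_torus_mult_continuous[OF max_int B_cont])
  have f0: "f x \<ge> 0" for x by (simp add: f_def B_def)
  have [measurable]: "f \<in> borel_measurable ?T" using f_int by auto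
  note k_meas[measurable] = measurable_torus_kernel_diff[where 'n = 'n]
  obtain A where A: "A > 0"
    "\<And>x :: real ^ 'n. x \<in> cbox 0 One \<Longrightarrow> (\<integral>\<^sup>+y. ennreal (torus_kernel (x - y) powr 1) \<partial>?T) \<le> ennreal A"
    using torus_kernel_powr_integral[where 'n = 'n and q = 1] by auto
  have col: "(\<integral>\<^sup>+x. ennreal (torus_kernel (x - y)) \<partial>?T) \<le> ennreal A" if "y \<in> space ?T" for y
    using A(2)[of y] that by (simp add: abs_of_nonneg[OF torus_kernel_nonneg] torus_kernel_minus_commute[of _ y] space_restrict_space)
  have int: "integrable (?T \<Otimes>\<^sub>M ?T) (\<lambda>(x, y). f y * torus_kernel (x - y))"
    using f_int f0 k_meas torus_kernel_nonneg less_imp_le[OF A(1)] col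
    by (rule T.integrable_pair_kernel_swap(1))
  define c where "c = average_const TYPE('n) / 2 ^ CARD('n)"
  have c: "c \<ge> 0" using average_const_pos[of "TYPE('n)"] by (simp add: c_def)
  define F where "F x = ennreal c * (\<integral>\<^sup>+y. ennreal (f y * torus_kernel (x - y)) \<partial>?T)" for x
  have [measurable]: "F \<in> borel_measurable ?T" unfolding F_def by measurable
  have "AE x in ?T. ennreal (max (m x) 0) \<le> F x"
  proof (rule AE_le_of_average_le)
    show "(\<lambda>x. ennreal (max (m x) 0)) \<in> borel_measurable ?T" using max_int by measurable
    show "(\<integral>\<^sup>+y. ennreal (max (m y) 0) \<partial>?T) < \<infinity>"
      using max_int by (simp add: nn_integral_eq_integral)
    have "(\<integral>\<^sup>+x. F x \<partial>?T) = ennreal c * (\<integral>\<^sup>+x. \<integral>\<^sup>+y. ennreal (f y * torus_kernel (x - y)) \<partial>?T \<partial>?T)"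
      unfolding F_def by (rule nn_integral_cmult) measurable
    also have "(\<integral>\<^sup>+x. \<integral>\<^sup>+y. ennreal (f y * torus_kernel (x - y)) \<partial>?T \<partial>?T)
        = (\<integral>\<^sup>+p. ennreal (case p of (x, y) \<Rightarrow> f y * torus_kernel (x - y)) \<partial>(?T \<Otimes>\<^sub>M ?T))"
      by (subst T.nn_integral_fst[symmetric]) auto
    also have "\<dots> = ennreal (\<integral>(x, y). f y * torus_kernel (x - y) \<partial>(?T \<Otimes>\<^sub>M ?T))"
      by (intro nn_integral_eq_integral int AE_I2)
        (auto split: prod.split intro!: mult_nonneg_nonneg f0 torus_kernel_nonneg)
    finally show "(\<integral>\<^sup>+x. F x \<partial>?T) < \<infinity>" by (simp add: ennreal_mult_less_top)
    fix a :: "real ^ 'n" and \<epsilon> :: real assume "\<epsilon> > 0"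
    have "ennreal ((2 * \<epsilon>) ^ CARD('n)) * F a
        = ennreal ((2 * \<epsilon>) ^ CARD('n) * c) * (\<integral>\<^sup>+y. ennreal (f y * torus_kernel (a - y)) \<partial>?T)"
      using c \<open>\<epsilon> > 0\<close> by (simp only: F_def ennreal_mult mult.assoc zero_le_power zero_le_mult_iff) (simp add: ennreal_mult mult.assoc)
    also have "(2 * \<epsilon>) ^ CARD('n) * c = average_const TYPE('n) * \<epsilon> ^ CARD('n)"
      by (simp add: c_def power_mult_distrib)
    finally show "(\<integral>\<^sup>+y. ennreal (max (m y) 0) * indicator {y. \<forall>i. \<bar>(y - a) $ i\<bar> < \<epsilon>} y \<partial>?T)
        \<le> ennreal ((2 * \<epsilon>) ^ CARD('n)) * F a"
      using average_le_potential[OF m sol b pos \<open>\<epsilon> > 0\<close>, of a] by (simp add: f_def B_def)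
  qed measurable
  then show ?thesis by (simp add: F_def c_def f_def B_def)
qed

lemma powr_add_one_le:
  fixes x p :: real
  assumes "x \<ge> 0" "p \<ge> 0" shows "(x + 1) powr p \<le> 2 powr p * (x powr p + 1)"
proof -
  have "(x + 1) powr p \<le> (2 * max x 1) powr p" using assms by (intro powr_mono2) auto
  also have "\<dots> = 2 powr p * max x 1 powr p" using assms by (simp add: powr_mult)
  also have "\<dots> \<le> 2 powr p * (x powr p + 1)"
    by (intro mult_left_mono) (auto simp: max_def)
  finally show ?thesis .
qed

text \<open>Since \<open>(\<gamma> - 1) * \<gamma>' = \<gamma>\<close>, the growth bound for the
  gradient of \<open>H\<close> turns the power \<open>\<gamma>'\<close> of the drift into the energy
  density.\<close>

lemma drift_powr_le:
  assumes H: "admissible_hamiltonian \<gamma> C\<^sub>H H" and \<gamma>: "\<gamma> > 1" "\<gamma>' = \<gamma> / (\<gamma> - 1)" and C\<^sub>H: "C\<^sub>H > 0"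
  shows "(norm (grad H p) + 1) powr \<gamma>' \<le> (2 * (C\<^sub>H + 1)) powr \<gamma>' * (norm p powr \<gamma> + 1)"
proof -
  have \<gamma>': "\<gamma>' \<ge> 0" "(\<gamma> - 1) * \<gamma>' = \<gamma>" using \<gamma> by auto
  have "norm (grad H p) \<le> C\<^sub>H * (norm p powr (\<gamma> - 1) + 1)"
    using H by (simp add: admissible_hamiltonian_def)
  moreover have "1 \<le> norm p powr (\<gamma> - 1) + 1" by simp
  moreover have "(C\<^sub>H + 1) * (norm p powr (\<gamma> - 1) + 1)
      = C\<^sub>H * (norm p powr (\<gamma> - 1) + 1) + (norm p powr (\<gamma> - 1) + 1)"
    by (simp add: distrib_right)
  ultimately have "norm (grad H p) + 1 \<le> (C\<^sub>H + 1) * (norm p powr (\<gamma> - 1) + 1)"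
    by linarith
  then have "(norm (grad H p) + 1) powr \<gamma>' \<le> ((C\<^sub>H + 1) * (norm p powr (\<gamma> - 1) + 1)) powr \<gamma>'"
    using \<gamma>' by (intro powr_mono2) auto
  also have "\<dots> = (C\<^sub>H + 1) powr \<gamma>' * (norm p powr (\<gamma> - 1) + 1) powr \<gamma>'"
    by (rule powr_mult)
  also have "\<dots> \<le> (C\<^sub>H + 1) powr \<gamma>' * (2 powr \<gamma>' * ((norm p powr (\<gamma> - 1)) powr \<gamma>' + 1))"
    using \<gamma>' by (intro mult_left_mono powr_add_one_le) auto
  also have "\<dots> = (2 * (C\<^sub>H + 1)) powr \<gamma>' * (norm p powr \<gamma> + 1)"
    by (simp only: powr_powr powr_mult \<gamma>'(2)) (simp only: mult_ac)
  finally show ?thesis .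
qed

text \<open>Three inequalities are chained: the trilinear estimate at the exponent
  \<open>\<beta>t = 1 / (1 - \<sigma>)\<close>, Jensen's inequality from the power \<open>a\<close>
  of the drift to \<open>\<gamma>'\<close>, and interpolation of \<open>\<beta>\<close> between 1
  and \<open>\<beta>t\<close>. The bounds on \<open>\<sigma>\<close> say that
  \<open>\<beta>t\<close> is finite and larger than \<open>\<beta>\<close>, and that the kernel is
  integrable to the power \<open>q\<close>. The pair \<open>a\<close>, \<open>\<sigma>\<close> stays
  free because the two claims of the theorem call for different choices.\<close>

lemma Lp_torus_estimate:
  fixes \<gamma> \<gamma>' \<beta> C\<^sub>H a \<sigma> :: real
  assumes \<gamma>: "\<gamma> > 1" "\<gamma>' = \<gamma> / (\<gamma> - 1)" and C\<^sub>H: "C\<^sub>H > 0" and \<beta>: "\<beta> > 1"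
    and a: "1 < a" "a \<le> \<gamma>'" and \<sigma>: "1 - 1 / \<beta> < \<sigma>" "\<sigma> < 1" "\<sigma> * real CARD('n) < a"
  shows "\<exists>C>0. \<forall>H :: real ^ 'n \<Rightarrow> real. admissible_hamiltonian \<gamma> C\<^sub>H H \<longrightarrow>
    (\<forall>u m. admissible_pair H u m \<longrightarrow> Lp_torus \<beta> m \<and>
      Lp_norm_torus \<beta> m powr (\<gamma>' * \<sigma> / (a * (1 - 1 / \<beta>)))
        \<le> C * (integral\<^sup>L torus_measure (\<lambda>x. norm (grad u x) powr \<gamma> * m x) + 1))"
proof -
  let ?T = "torus_measure :: (real ^ 'n) measure"
  interpret T: finite_measure ?T by (rule finite_measure_torus)
  define n where "n = real CARD('n)"
  have n: "n \<ge> 1" by (simp add: n_def Suc_le_eq)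
  have \<sigma>0: "0 < \<sigma>" using \<sigma>(1) \<beta> by (smt (verit) divide_less_eq_1)
  have \<sigma>a: "0 < \<sigma> / a" "\<sigma> / a < 1" using \<sigma>0 \<sigma>(2) a by auto
  define q where "q = 1 / (1 - \<sigma> / a)"
  have q: "q > 1" "q * (1 - \<sigma> / a) = 1" using \<sigma>a by (auto simp: q_def)
  have "n - 1 < n * (1 - \<sigma> / a)" using \<sigma>(3) a by (simp add: n_def field_simps)
  then have "q * (n - 1) < q * (n * (1 - \<sigma> / a))" using q by simp
  then have "q * (n - 1) < n" using q by (simp add: mult.left_commute)
  then obtain A where A: "A > 0"
    "\<And>x :: real ^ 'n. x \<in> cbox 0 One \<Longrightarrow> (\<integral>\<^sup>+y. ennreal (torus_kernel (x - y) powr q) \<partial>?T) \<le> ennreal A"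
    using torus_kernel_powr_integral[where 'n = 'n and q = q] q by (auto simp: n_def)
  define \<beta>t where "\<beta>t = 1 / (1 - \<sigma>)"
  have \<beta>t: "\<beta>t * (1 - \<sigma>) = 1" using \<sigma> by (simp add: \<beta>t_def)
  have \<beta>\<beta>t: "\<beta> < \<beta>t" using \<sigma> \<beta> by (simp add: \<beta>t_def field_simps)
  \<comment> \<open>Determined by \<open>\<beta> = (1 - t) * 1 + t * \<beta>t\<close>, the
    interpolation identity for the integrals of powers.\<close>
  define t where "t = (\<beta> - 1) / (\<beta>t - 1)"
  have t: "0 < t" "t < 1" using \<beta> \<beta>\<beta>t by (auto simp: t_def)
  have t_eq: "1 - t + \<beta>t * t = \<beta>"
  proof -
    have "t * (\<beta>t - 1) = \<beta> - 1" using \<beta> \<beta>\<beta>t by (simp add: t_def)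
    then show ?thesis by (simp add: algebra_simps)
  qed
  define c where "c = average_const TYPE('n) / 2 ^ CARD('n)"
  have c: "c > 0" using average_const_pos[of "TYPE('n)"] by (simp add: c_def)
  define C1 where "C1 = c powr a * A powr (a - \<sigma>)"
  have C1: "C1 > 0" using c A by (simp add: C1_def)
  define C2 where "C2 = (2 * (C\<^sub>H + 1)) powr \<gamma>'"
  have C2: "C2 > 0" using C\<^sub>H by (simp add: C2_def)
  \<comment> \<open>The exponent in \<open>\<parallel>m\<parallel>\<^sub>\<beta> \<le>
    \<parallel>m\<parallel>\<^sub>\<beta>\<^sub>t powr \<theta>\<close>: as
    \<open>1 / \<beta>t = 1 - \<sigma>\<close>, the relation
    \<open>1 / \<beta> = 1 - \<theta> + \<theta> / \<beta>t\<close> reads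
    \<open>\<theta> * \<sigma> = 1 - 1 / \<beta>\<close>.\<close>
  define \<theta> where "\<theta> = (1 - 1 / \<beta>) / \<sigma>"
  have \<theta>: "\<theta> > 0" using \<beta> \<sigma>0 by (simp add: \<theta>_def)
  have \<theta>_eq: "t / \<beta> = (1 - \<sigma>) * \<theta>"
  proof -
    have "\<beta>t - 1 = \<sigma> / (1 - \<sigma>)" using \<sigma> by (simp add: \<beta>t_def field_simps)
    then have "t = (\<beta> - 1) * ((1 - \<sigma>) / \<sigma>)" by (simp add: t_def)
    moreover have "1 - 1 / \<beta> = (\<beta> - 1) / \<beta>" using \<beta> by (simp add: field_simps)
    ultimately show ?thesis by (simp add: \<theta>_def mult.commute)
  qed
  \<comment> \<open>Chosen so that \<open>\<theta> * D = \<gamma>' / a\<close>, which undoes the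
    power \<open>a / \<gamma>'\<close> from Jensen's inequality and leaves the energy
    linear.\<close>
  define D where "D = \<gamma>' * \<sigma> / (a * (1 - 1 / \<beta>))"
  have \<theta>D: "\<theta> * D = \<gamma>' / a" using \<beta> \<sigma>0 a by (simp add: \<theta>_def D_def)
  have D: "D > 0" using \<beta> \<sigma>0 a by (simp add: D_def)
  show ?thesis
  proof (intro exI[of _ "C1 powr (\<gamma>' / a) * C2"] conjI allI impI)
    show "C1 powr (\<gamma>' / a) * C2 > 0" using C1 C2 by simp
    fix H u m :: "real ^ 'n \<Rightarrow> real"
    assume H: "admissible_hamiltonian \<gamma> C\<^sub>H H" and um: "admissible_pair H u m"
    have W12: "W12_torus m" and sol: "weak_solution H u m" and m1: "integral\<^sup>L ?T m = 1"
      and pos: "AE x in ?T. m x > 0" and u: "Ck_on (Suc (Suc 0)) UNIV u"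
      using um by (auto simp: admissible_pair_def Ck_torus_def numeral_2_eq_2)
    have gu: "continuous_on UNIV (grad u)" using u by (rule continuous_on_grad_Ck)
    have "continuous_on UNIV (grad H)"
      using H by (intro continuous_on_grad_Ck[of 0]) (simp add: admissible_hamiltonian_def)
    from continuous_on_compose2[OF this gu]
    have b: "continuous_on UNIV (\<lambda>x. grad H (grad u x))" by simp
    define B where "B x = norm (grad H (grad u x)) + 1" for x
    have B1: "B x \<ge> 1" and B0: "B x \<ge> 0" for x by (simp_all add: B_def)
    have B_cont: "continuous_on UNIV B" unfolding B_def by (intro continuous_intros b)
    have [measurable]: "B \<in> borel_measurable ?T"
      by (intro borel_measurable_torus borel_measurable_continuous_onI B_cont)
    obtain KB where KB: "\<And>x. x \<in> space ?T \<Longrightarrow> \<bar>B x\<bar> \<le> KB"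
      using continuous_bounded_torus[OF B_cont] by blast
    have KB': "B x \<le> KB" if "x \<in> space ?T" for x
      using KB[OF that] by simp
    have mint: "integrable ?T m"
      using has_weak_grad_weak_grad[OF W12] by (auto simp: has_weak_grad_def intro: integrable_of_Lp_torus_1)
    have [measurable]: "m \<in> borel_measurable ?T" using mint by auto
    define M where "M x = max (m x) 0" for x
    have M_int: "integrable ?T M" unfolding M_def using mint by (intro integrable_max) auto
    have M0: "M x \<ge> 0" for x by (simp add: M_def)
    have [measurable]: "M \<in> borel_measurable ?T" using M_int by auto
    have mM: "AE x in ?T. m x = M x" using pos by eventually_elim (simp add: M_def)
    have M1: "integral\<^sup>L ?T M = 1"
      unfolding m1[symmetric] using mM by (intro integral_cong_AE) auto
    have ineq: "AE x in ?T. ennreal (M x) \<le> ennreal c * (\<integral>\<^sup>+y. ennreal (M y * B y * torus_kernel (x - y)) \<partial>?T)"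
      using kernel_inequality[OF W12 sol b pos] by (simp add: M_def c_def B_def)
    note k_meas[measurable] = measurable_torus_kernel_diff[where 'n = 'n]
    have row: "(\<integral>\<^sup>+y. ennreal (torus_kernel (x - y) powr q) \<partial>?T) \<le> ennreal A" if "x \<in> space ?T" for x
      using A(2)[of x] that by (simp add: space_restrict_space)
    have col: "(\<integral>\<^sup>+x. ennreal (torus_kernel (x - y) powr q) \<partial>?T) \<le> ennreal A" if "y \<in> space ?T" for y
      using row[OF that] by (simp add: torus_kernel_minus_commute[of _ y])
    have KB0: "KB \<ge> 0" using KB[of 0] by (simp add: mem_box space_restrict_space)
    \<comment> \<open>The bound obtained here depends on \<open>KB\<close>, hence on
      \<open>u\<close>. It is harmless: the inequality in \<open>est\<close> contains only
      \<open>c\<close>, \<open>A\<close> and the exponents.\<close>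
    have "\<exists>K\<ge>0. AE x in ?T. M x \<le> K"
    proof (rule T.bounded_of_kernel_inequality[OF M_int M0 k_meas torus_kernel_nonneg q(1) less_imp_le[OF A(1)] _ row col])
      show "c * KB \<ge> 0" using c KB0 by simp
      show "AE x in ?T. ennreal (M x) \<le> ennreal (c * KB) * (\<integral>\<^sup>+y. ennreal (M y * torus_kernel (x - y)) \<partial>?T)"
        using ineq AE_space
      proof eventually_elim
        case (elim x)
        have [measurable]: "(\<lambda>y. torus_kernel (x - y)) \<in> borel_measurable ?T"
          using measurable_Pair2[OF k_meas elim(2)] by simp
        have "(\<integral>\<^sup>+y. ennreal (M y * B y * torus_kernel (x - y)) \<partial>?T)
            \<le> (\<integral>\<^sup>+y. ennreal KB * ennreal (M y * torus_kernel (x - y)) \<partial>?T)"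
        proof (rule nn_integral_mono)
          fix y assume "y \<in> space ?T"
          then have "B y * (M y * torus_kernel (x - y)) \<le> KB * (M y * torus_kernel (x - y))"
            using KB' by (intro mult_right_mono mult_nonneg_nonneg M0 torus_kernel_nonneg)
          then have "ennreal (M y * B y * torus_kernel (x - y)) \<le> ennreal (KB * (M y * torus_kernel (x - y)))"
            by (intro ennreal_leI) (simp add: mult_ac)
          also have "\<dots> = ennreal KB * ennreal (M y * torus_kernel (x - y))"
            using KB0 by (rule ennreal_mult')
          finally show "ennreal (M y * B y * torus_kernel (x - y)) \<le> ennreal KB * ennreal (M y * torus_kernel (x - y))" .
        qed
        also have "\<dots> = ennreal KB * (\<integral>\<^sup>+y. ennreal (M y * torus_kernel (x - y)) \<partial>?T)"
          by (rule nn_integral_cmult) measurable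
        finally have "ennreal (M x) \<le> ennreal c * (ennreal KB * (\<integral>\<^sup>+y. ennreal (M y * torus_kernel (x - y)) \<partial>?T))"
          using elim(1) by (meson mult_left_mono order_trans zero_le)
        moreover have "ennreal (c * KB) = ennreal c * ennreal KB"
          using c by (intro ennreal_mult') auto
        ultimately show ?case by (simp only: mult.assoc)
      qed
    qed auto
    then obtain K where K: "AE x in ?T. M x \<le> K" by blast
    note est = T.Lp_estimate_of_kernel_inequality[OF M_int M0 K \<open>B \<in> borel_measurable ?T\<close> B0 KB' k_meas
      torus_kernel_nonneg A(1) less_imp_le[OF c] a(1) \<sigma>0 \<sigma>(2) q(2) \<beta>t row col ineq]
    \<comment> \<open>The summand 1 in \<open>B\<close> keeps it away from 0, so all its real powers
      are continuous.\<close>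
    have B_powr: "integrable ?T (\<lambda>x. M x * B x powr p)" for p
    proof (intro integrable_torus_mult_continuous M_int continuous_on_powr B_cont continuous_intros ballI)
      show "B x \<noteq> 0" for x using B1[of x] by linarith
    qed
    define Ea where "Ea = (\<integral>x. M x * B x powr a \<partial>?T)"
    define E where "E = (\<integral>x. M x * B x powr \<gamma>' \<partial>?T)"
    have E0: "E \<ge> 0" using M0 by (simp add: E_def)
    \<comment> \<open>Jensen's inequality for the probability density \<open>M\<close>, in the form
      of a two-factor Hoelder inequality whose weights must lie strictly between 0 and 1; hence the
      separate case \<open>a = \<gamma>'\<close>.\<close>
    have Ea_le: "Ea \<le> E powr (a / \<gamma>')"
    proof (cases "a = \<gamma>'")
      case True
      then show ?thesis using a E0 by (simp add: Ea_def E_def)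
    next
      case False
      define r where "r = a / \<gamma>'"
      have r: "0 < r" "r < 1" "\<gamma>' * r = a" using a False by (auto simp: r_def)
      have "Ea = (\<integral>x. M x powr (1 - r) * (M x * B x powr \<gamma>') powr r \<partial>?T)"
        unfolding Ea_def
      proof (intro Bochner_Integration.integral_cong refl)
        fix x
        have "M x powr (1 - r) * (M x * B x powr \<gamma>') powr r = M x powr (1 - r) * M x powr r * B x powr a"
          using M0[of x] B0[of x] r(3) by (simp add: powr_mult powr_powr)
        also have "M x powr (1 - r) * M x powr r = M x" using M0[of x] by (simp flip: powr_add)
        finally show "M x * B x powr a = M x powr (1 - r) * (M x * B x powr \<gamma>') powr r" by simp
      qed
      also have "\<dots> \<le> (\<integral>x. M x \<partial>?T) powr (1 - r) * E powr r"
        unfolding E_def using M0 by (intro Holder_inequality_two r M_int B_powr) auto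
      finally show ?thesis using M1 by (simp add: r_def)
    qed
    define X where "X = (\<integral>x. M x powr \<beta>t \<partial>?T)"
    have M_powr: "M x powr (1 - t) * (M x powr \<beta>t) powr t = M x powr \<beta>" for x
      using M0[of x] t_eq by (simp add: powr_powr flip: powr_add)
    have "M x powr \<beta>t \<ge> 0" for x by (rule powr_ge_zero)
    note interp = Holder_inequality_two[OF t M_int est(1) M0 this, unfolded M_powr]
    define Y where "Y = (\<integral>x. M x powr \<beta> \<partial>?T)"
    have Y0: "Y \<ge> 0" by (simp add: Y_def)
    have M\<beta>: "integrable ?T (\<lambda>x. M x powr \<beta>)" by (rule interp(1))
    have Y_le: "Y \<le> X powr t" using interp(2) M1 by (simp add: X_def Y_def)
    have X_le: "X powr (1 - \<sigma>) \<le> C1 * E powr (a / \<gamma>')"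
      using est(3) mult_left_mono[OF Ea_le, of C1] C1 by (simp add: X_def Ea_def C1_def)
    have "Y powr (1 / \<beta>) \<le> (X powr t) powr (1 / \<beta>)"
      using Y_le Y0 \<beta> by (intro powr_mono2) auto
    also have "\<dots> = (X powr (1 - \<sigma>)) powr \<theta>"
      using \<theta>_eq by (simp add: powr_powr)
    finally have "(Y powr (1 / \<beta>)) powr D \<le> ((X powr (1 - \<sigma>)) powr \<theta>) powr D"
      using D by (intro powr_mono2) auto
    also have "\<dots> = (X powr (1 - \<sigma>)) powr (\<gamma>' / a)"
      by (simp add: powr_powr \<theta>D mult.assoc)
    also have "\<dots> \<le> (C1 * E powr (a / \<gamma>')) powr (\<gamma>' / a)"
      using X_le a by (intro powr_mono2) auto
    also have "\<dots> = C1 powr (\<gamma>' / a) * E"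
      using C1 E0 a by (simp add: powr_mult powr_powr)
    finally have Y_D: "(Y powr (1 / \<beta>)) powr D \<le> C1 powr (\<gamma>' / a) * E" .
    have gu_int: "integrable ?T (\<lambda>x. M x * norm (grad u x) powr \<gamma>)"
      using \<gamma> by (intro integrable_torus_mult_continuous M_int continuous_on_powr' continuous_intros gu) auto
    have "E \<le> (\<integral>x. C2 * (M x * norm (grad u x) powr \<gamma> + M x) \<partial>?T)"
      unfolding E_def
    proof (intro integral_mono B_powr)
      show "integrable ?T (\<lambda>x. C2 * (M x * norm (grad u x) powr \<gamma> + M x))" using gu_int M_int by auto
      fix x
      show "M x * B x powr \<gamma>' \<le> C2 * (M x * norm (grad u x) powr \<gamma> + M x)"
        using mult_left_mono[OF drift_powr_le[OF H \<gamma> C\<^sub>H, of "grad u x"] M0[of x]]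
        by (simp add: B_def C2_def algebra_simps)
    qed
    also have "\<dots> = C2 * ((\<integral>x. M x * norm (grad u x) powr \<gamma> \<partial>?T) + 1)"
      using gu_int M_int M1 by simp
    also have "(\<integral>x. M x * norm (grad u x) powr \<gamma> \<partial>?T) = (\<integral>x. norm (grad u x) powr \<gamma> * m x \<partial>?T)"
    proof (rule integral_cong_AE)
      have [measurable]: "(\<lambda>x. norm (grad u x)) \<in> borel_measurable ?T"
        by (intro borel_measurable_torus borel_measurable_continuous_onI continuous_intros gu)
      show "(\<lambda>x. M x * norm (grad u x) powr \<gamma>) \<in> borel_measurable ?T" by measurable
      show "(\<lambda>x. norm (grad u x) powr \<gamma> * m x) \<in> borel_measurable ?T" by measurable
      show "AE x in ?T. M x * norm (grad u x) powr \<gamma> = norm (grad u x) powr \<gamma> * m x"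
        using mM by eventually_elim simp
    qed
    finally have "C1 powr (\<gamma>' / a) * E
        \<le> C1 powr (\<gamma>' / a) * (C2 * ((\<integral>x. norm (grad u x) powr \<gamma> * m x \<partial>?T) + 1))"
      by (intro mult_left_mono) auto
    with Y_D have final: "(Y powr (1 / \<beta>)) powr D
        \<le> C1 powr (\<gamma>' / a) * C2 * ((\<integral>x. norm (grad u x) powr \<gamma> * m x \<partial>?T) + 1)"
      by (simp only: mult.assoc)
    have norm_eq: "AE x in ?T. norm (m x) powr \<beta> = M x powr \<beta>"
      using pos by eventually_elim (simp add: M_def)
    show "Lp_torus \<beta> m"
      unfolding Lp_torus_def
    proof (intro conjI)
      show "torus_periodic m" using W12 by (simp add: W12_torus_def Lp_torus_def)
      show "integrable ?T (\<lambda>x. norm (m x) powr \<beta>)"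
        using M\<beta> norm_eq by (subst integrable_cong_AE[where g = "\<lambda>x. M x powr \<beta>"]) auto
    qed measurable
    have "Lp_norm_torus \<beta> m = Y powr (1 / \<beta>)"
      unfolding Lp_norm_torus_def Y_def using norm_eq by (subst integral_cong_AE[where g = "\<lambda>x. M x powr \<beta>"]) auto
    then show "Lp_norm_torus \<beta> m powr (\<gamma>' * \<sigma> / (a * (1 - 1 / \<beta>)))
        \<le> C1 powr (\<gamma>' / a) * C2 * (integral\<^sup>L ?T (\<lambda>x. norm (grad u x) powr \<gamma> * m x) + 1)"
      using final by (simp add: D_def)
  qed
qed

section \<open>Choice of the exponents\<close>

lemma exists_exponent_subcritical:
  fixes \<gamma>' \<beta> N :: real
  assumes N: "N \<ge> 1" and \<gamma>': "\<gamma>' > 1" and \<beta>: "\<beta> > 1" and crit: "\<gamma>' < N \<longrightarrow> \<beta> < 1 + \<gamma>' / (N - \<gamma>')"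
  shows "\<exists>\<sigma>. 1 - 1 / \<beta> < \<sigma> \<and> \<sigma> < 1 \<and> \<sigma> * N < \<gamma>'"
proof -
  have s: "0 < 1 - 1 / \<beta>" "1 - 1 / \<beta> < 1" using \<beta> by auto
  \<comment> \<open>A restatement of subcriticality: for \<open>\<gamma>' < N\<close> the bound on
    \<open>\<beta>\<close> is \<open>N / (N - \<gamma>')\<close>. The strict inequality leaves room
    for some \<open>\<sigma>\<close> above \<open>1 - 1 / \<beta>\<close>, and this room becomes
    \<open>\<delta> > 1\<close>.\<close>
  have sN: "(1 - 1 / \<beta>) * N < \<gamma>'"
  proof (cases "\<gamma>' < N")
    case True
    then have "(\<beta> - 1) * (N - \<gamma>') < \<gamma>'" using crit by (simp add: field_simps)
    then show ?thesis using \<beta> by (simp add: field_simps)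
  next
    case False
    have "(1 - 1 / \<beta>) * N < 1 * N" using s N by (intro mult_strict_right_mono) auto
    with False show ?thesis by simp
  qed
  have "1 - 1 / \<beta> < min 1 (\<gamma>' / N)" using s(2) sN N by (simp add: pos_less_divide_eq)
  then obtain \<sigma> where \<sigma>: "1 - 1 / \<beta> < \<sigma>" "\<sigma> < min 1 (\<gamma>' / N)" using dense by blast
  then have "\<sigma> < 1" "\<sigma> * N < \<gamma>'" using N by (simp_all add: pos_less_divide_eq)
  with \<sigma>(1) show ?thesis by blast
qed

text \<open>For \<open>\<gamma>' > N\<close> the integrability of the drift has to be lowered to some \<open>a\<close> close to \<open>N\<close>
  to reach the full range of \<open>\<beta>\<close>.\<close>

lemma exists_exponents_superlinear:
  fixes \<gamma>' \<beta> N :: real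
  assumes N: "N \<ge> 1" and \<gamma>': "\<gamma>' > 1" and \<beta>: "\<beta> > 1" and crit: "\<beta> < 1 + \<gamma>' / N"
  shows "\<exists>a \<sigma>. 1 < a \<and> a \<le> \<gamma>' \<and> 1 - 1 / \<beta> < \<sigma> \<and> a * (\<beta> - 1) < \<gamma>' * \<sigma> \<and> \<sigma> < 1 \<and> \<sigma> * N < a"
proof -
  define s where "s = 1 - 1 / \<beta>"
  have s: "s < 1" using \<beta> by (simp add: s_def)
  have "\<beta> - 1 < \<gamma>' / N" using crit by simp
  have \<beta>N: "(\<beta> - 1) * N < \<gamma>'" using \<open>\<beta> - 1 < \<gamma>' / N\<close> N by (simp add: pos_less_divide_eq)
  \<comment> \<open>A \<open>\<sigma>\<close> must fit between the lower bounds \<open>s\<close> and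
    \<open>a * (\<beta> - 1) / \<gamma>'\<close>, the latter encoding \<open>\<delta> > 1\<close>,
    and the upper bounds 1 and \<open>a / N\<close>. For \<open>\<gamma>' \<le> N\<close> the choice
    \<open>a = \<gamma>'\<close> works. Otherwise \<open>a\<close> is taken just above
    \<open>N\<close>, so that \<open>a / N\<close> exceeds 1 while \<open>a * (\<beta> - 1)\<close>
    stays below \<open>\<gamma>'\<close>.\<close>
  have "\<exists>a. 1 < a \<and> a \<le> \<gamma>' \<and> s < a / N \<and> a * (\<beta> - 1) / \<gamma>' < 1 \<and> a * (\<beta> - 1) / \<gamma>' < a / N"
  proof (cases "\<gamma>' \<le> N")
    case True
    have "s = (\<beta> - 1) / \<beta>" using \<beta> by (simp add: s_def field_simps)
    also have "\<dots> \<le> (\<beta> - 1) / 1" using \<beta> by (intro divide_left_mono) auto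
    finally have "s < \<gamma>' / N" using \<open>\<beta> - 1 < \<gamma>' / N\<close> by simp
    moreover have "\<gamma>' / N \<le> 1" using True N by simp
    ultimately show ?thesis using \<gamma>' \<open>\<beta> - 1 < \<gamma>' / N\<close> by (intro exI[of _ \<gamma>']) auto
  next
    case False
    then have "N < \<gamma>' / (\<beta> - 1)" using \<beta>N \<beta> by (simp add: pos_less_divide_eq mult.commute)
    with False have "N < min \<gamma>' (\<gamma>' / (\<beta> - 1))" by simp
    then obtain a where a: "N < a" "a < min \<gamma>' (\<gamma>' / (\<beta> - 1))" using dense by blast
    then have "a * (\<beta> - 1) < \<gamma>'" using \<beta> by (simp add: pos_less_divide_eq)
    then have "a * (\<beta> - 1) / \<gamma>' < 1" using \<gamma>' by simp
    moreover have "1 < a / N" using a N by simp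
    ultimately have "s < a / N" "a * (\<beta> - 1) / \<gamma>' < a / N" using s by linarith+
    with a N \<open>a * (\<beta> - 1) / \<gamma>' < 1\<close> show ?thesis by (intro exI[of _ a]) auto
  qed
  then obtain a where a: "1 < a" "a \<le> \<gamma>'" "max s (a * (\<beta> - 1) / \<gamma>') < min 1 (a / N)"
    using s by auto
  then obtain \<sigma> where "max s (a * (\<beta> - 1) / \<gamma>') < \<sigma>" "\<sigma> < min 1 (a / N)" using dense by blast
  then have "s < \<sigma>" "a * (\<beta> - 1) / \<gamma>' < \<sigma>" "\<sigma> < 1" "\<sigma> < a / N" by auto
  then have "s < \<sigma>" "a * (\<beta> - 1) < \<gamma>' * \<sigma>" "\<sigma> < 1" "\<sigma> * N < a"
    using N \<gamma>' by (simp_all add: pos_less_divide_eq pos_divide_less_eq mult.commute)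
  with a show ?thesis unfolding s_def by blast
qed

theorem corollary2p4:
  fixes \<gamma> \<gamma>' \<beta> C\<^sub>H N :: real
  assumes "N = real CARD('n::finite)"
    and "\<gamma> > 1" and "\<gamma>' = \<gamma> / (\<gamma> - 1)"
    and "C\<^sub>H > 0"
    and "\<beta> > 1" and "\<gamma>' < N \<longrightarrow> \<beta> < 1 + \<gamma>' / (N - \<gamma>')"
  shows
    "(\<exists>C \<delta>. C > 0 \<and> \<delta> > 1 \<and>
       (\<forall>H :: real ^ 'n \<Rightarrow> real. admissible_hamiltonian \<gamma> C\<^sub>H H \<longrightarrow>
         (\<forall>u m. admissible_pair H u m \<longrightarrow>
           Lp_torus \<beta> m \<and>
           Lp_norm_torus \<beta> m powr \<delta>
             \<le> C * (integral\<^sup>L torus_measure (\<lambda>x. norm (grad u x) powr \<gamma> * m x) + 1)))) \<and>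
     (\<beta> < 1 + \<gamma>' / N \<longrightarrow>
      (\<exists>C \<delta>. C > 0 \<and> \<delta> > 1 \<and>
       (\<forall>H :: real ^ 'n \<Rightarrow> real. admissible_hamiltonian \<gamma> C\<^sub>H H \<longrightarrow>
         (\<forall>u m. admissible_pair H u m \<longrightarrow>
           Lp_torus \<beta> m \<and>
           Lp_norm_torus \<beta> m powr (\<delta> * \<beta>)
             \<le> C * (integral\<^sup>L torus_measure (\<lambda>x. norm (grad u x) powr \<gamma> * m x) + 1)))))"
proof (intro conjI impI)
  have N: "N \<ge> 1" using assms(1) by (simp add: Suc_le_eq)
  have \<gamma>': "\<gamma>' > 1" using assms(2,3) by simp
  define P where "P \<rho> C = (\<forall>H :: real ^ 'n \<Rightarrow> real. admissible_hamiltonian \<gamma> C\<^sub>H H \<longrightarrow>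
    (\<forall>u m. admissible_pair H u m \<longrightarrow> Lp_torus \<beta> m \<and>
      Lp_norm_torus \<beta> m powr \<rho>
        \<le> C * (integral\<^sup>L torus_measure (\<lambda>x. norm (grad u x) powr \<gamma> * m x) + 1)))" for \<rho> C
  have est: "\<exists>C>0. P (\<gamma>' * \<sigma> / (a * (1 - 1 / \<beta>))) C"
    if "1 < a" "a \<le> \<gamma>'" "1 - 1 / \<beta> < \<sigma>" "\<sigma> < 1" "\<sigma> * N < a" for a \<sigma>
    unfolding P_def using that unfolding assms(1) by (rule Lp_torus_estimate[OF assms(2-5)])
  obtain \<sigma> where \<sigma>: "1 - 1 / \<beta> < \<sigma>" "\<sigma> < 1" "\<sigma> * N < \<gamma>'"
    using exists_exponent_subcritical[OF N \<gamma>' assms(5,6)] by blast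
  then obtain C where "C > 0" "P (\<gamma>' * \<sigma> / (\<gamma>' * (1 - 1 / \<beta>))) C"
    using est[OF \<gamma>' order_refl] by blast
  \<comment> \<open>With \<open>a = \<gamma>'\<close> the exponent reduces to
    \<open>\<sigma> / (1 - 1 / \<beta>)\<close>.\<close>
  moreover have "\<gamma>' * \<sigma> / (\<gamma>' * (1 - 1 / \<beta>)) > 1" using \<sigma>(1) \<gamma>' assms(5) by simp
  ultimately have "\<exists>C \<delta>. C > 0 \<and> \<delta> > 1 \<and> P \<delta> C" by blast
  then show "\<exists>C \<delta>. C > 0 \<and> \<delta> > 1 \<and>
       (\<forall>H :: real ^ 'n \<Rightarrow> real. admissible_hamiltonian \<gamma> C\<^sub>H H \<longrightarrow>
         (\<forall>u m. admissible_pair H u m \<longrightarrow>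
           Lp_torus \<beta> m \<and>
           Lp_norm_torus \<beta> m powr \<delta>
             \<le> C * (integral\<^sup>L torus_measure (\<lambda>x. norm (grad u x) powr \<gamma> * m x) + 1)))"
    by (simp only: P_def)
  assume "\<beta> < 1 + \<gamma>' / N"
  then obtain a \<sigma> where a: "1 < a" "a \<le> \<gamma>'" and \<sigma>: "1 - 1 / \<beta> < \<sigma>" "\<sigma> < 1" "\<sigma> * N < a"
    and lt: "a * (\<beta> - 1) < \<gamma>' * \<sigma>"
    using exists_exponents_superlinear[OF N \<gamma>' assms(5)] by blast
  \<comment> \<open>The exponent supplied by \<open>est\<close>, divided by
    \<open>\<beta>\<close>.\<close>
  define \<delta> where "\<delta> = \<gamma>' * \<sigma> / (a * (\<beta> - 1))"
  have "\<gamma>' * \<sigma> / (a * (1 - 1 / \<beta>)) = \<delta> * \<beta>"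
  proof -
    have "1 - 1 / \<beta> = (\<beta> - 1) / \<beta>" using assms(5) by (simp add: field_simps)
    then show ?thesis by (simp add: \<delta>_def)
  qed
  then obtain C where "C > 0" "P (\<delta> * \<beta>) C" using est[OF a \<sigma>] by auto
  moreover have "\<delta> > 1" using lt a assms(5) by (simp add: \<delta>_def)
  ultimately have "\<exists>C \<delta>. C > 0 \<and> \<delta> > 1 \<and> P (\<delta> * \<beta>) C" by blast
  then show "\<exists>C \<delta>. C > 0 \<and> \<delta> > 1 \<and>
       (\<forall>H :: real ^ 'n \<Rightarrow> real. admissible_hamiltonian \<gamma> C\<^sub>H H \<longrightarrow>
         (\<forall>u m. admissible_pair H u m \<longrightarrow>
           Lp_torus \<beta> m \<and>
           Lp_norm_torus \<beta> m powr (\<delta> * \<beta>)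
             \<le> C * (integral\<^sup>L torus_measure (\<lambda>x. norm (grad u x) powr \<gamma> * m x) + 1)))"
    by (simp only: P_def)
qed

end
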